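(* Fix an integer $\nu\ge1$ and $p\in\mathbb R$. Say that the approximation rate with power $p$ is achieved if for each positive integer $W$ there is a ReLU network architecture $\eta_W$ with $\nu$ inputs and $W$ weights and a weight assignment $f\mapsto$ (weights of $\eta_W$), producing network functions $\widetilde f_W$, such that $$\|f-\widetilde f_W\|_\infty\le a\,\omega_f(cW^{-p})\quad \text{for all } f\in C([0,1]^\nu)\text{ and all } W,$$ with constants $a,c$ (possibly depending on $\nu,p$) independent of $W$ and $f$. Then: (a) The approximation rate with power $p$ cannot be achieved if $p>\frac{2}{\nu}$. (b) The approximation rate with power $p$ cannot be achieved if $p>\frac1\nu$ and the weights of $\widetilde f_W$ are required to depend continuously on $f$ with respect to the standard (sup-norm) topology of $C([0,1]^\nu)$. (c) If the approximation rate with power $p$ is achieved for some $p\in(\frac1\nu,\frac2\nu]$, then the architectures $\eta_W$ must have depths $L\ge d\,W^{p\nu-1}/\ln W$ with some constant $d>0$ possibly depending on $\nu$ and $p$.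
   Context: For $f:[0,1]^\nu\to\mathbb R$ continuous, $\omega_f(r)=\max\{|f(\mathbf x)-f(\mathbf y)|:\mathbf x,\mathbf y\in[0,1]^\nu,\ |\mathbf x-\mathbf y|\le r\}$ (Euclidean norm). A ReLU network is a feed-forward network with $\nu$ input units, hidden units grouped into a sequence of layers (each unit taking inputs from outputs of units in earlier layers, arbitrary such connections allowed), and one output unit. A hidden unit computes $(x_1,\dots,x_s)\mapsto(\sum_kw_kx_k+h)_+$, $t_+=\max(0,t)$; the output unit computes $\sum_kw_kx_k+h$. The depth $L$ is the number of hidden layers; the number of weights $W$ is the number of connections plus the number of computation (hidden and output) units. A weight assignment is a rule choosing all weight values of $\eta_W$ depending on $f$, and $\widetilde f_W$ is the resulting network function. $\|\cdot\|_\infty$ is the sup norm on $[0,1]^\nu$.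
   Formalization: In (c) the depth bound is stated for all sufficiently large W, with d and the threshold allowed to depend on the given family (through a and c); for small W it fails, since depth-0 networks can meet the rate and ln 1 = 0. *)

theory Defs
  imports "HOL-Analysis.Analysis"
begin

definition unit_cube :: "(real ^ 'n) set" where
  "unit_cube = {x. \<forall>i. 0 \<le> x $ i \<and> x $ i \<le> 1}"

definition sup_dist :: "(real ^ 'n \<Rightarrow> real) \<Rightarrow> (real ^ 'n \<Rightarrow> real) \<Rightarrow> real" where
  "sup_dist f g = Sup {\<bar>f x - g x\<bar> | x. x \<in> unit_cube}"

definition modcont :: "(real ^ 'n \<Rightarrow> real) \<Rightarrow> real \<Rightarrow> real" where
  "modcont f r = Sup {\<bar>f x - f y\<bar> | x y. x \<in> unit_cube \<and> y \<in> unit_cube \<and> dist x y \<le> r}"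

text \<open>Nodes: input units (indexed by the coordinate type), hidden unit number j of
  hidden layer l (layers 1..L), and the output unit.\<close>
datatype 'i node = In 'i | Hid nat nat | Out

record 'i arch =
  depth :: nat                     \<comment> \<open>number L of hidden layers\<close>
  width :: "nat \<Rightarrow> nat"
  edges :: "('i node \<times> 'i node) set"  \<comment> \<open>connections (source, target)\<close>

definition is_hidden :: "'i arch \<Rightarrow> 'i node \<Rightarrow> bool" where
  "is_hidden A u = (case u of Hid l j \<Rightarrow> 1 \<le> l \<and> l \<le> depth A \<and> j < width A l | _ \<Rightarrow> False)"

definition layer_of :: "'i arch \<Rightarrow> 'i node \<Rightarrow> nat" where
  "layer_of A u = (case u of In i \<Rightarrow> 0 | Hid l j \<Rightarrow> l | Out \<Rightarrow> Suc (depth A))"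

definition wf_arch :: "'i arch \<Rightarrow> bool" where
  "wf_arch A =
    ((\<forall>l\<in>{1..depth A}. 1 \<le> width A l) \<and>
     (\<forall>(s, t) \<in> edges A.
        ((\<exists>i. s = In i) \<or> is_hidden A s) \<and> (is_hidden A t \<or> t = Out) \<and>
        layer_of A s < layer_of A t))"

text \<open>Number of weights: connections plus computation units (hidden units and the output).\<close>
definition num_weights :: "'i arch \<Rightarrow> nat" where
  "num_weights A = card (edges A) + (\<Sum>l=1..depth A. width A l) + 1"

text \<open>Weights: a weight for each connection and a bias for each computation unit.\<close>
type_synonym 'i weights = "(('i node \<times> 'i node) \<Rightarrow> real) \<times> ('i node \<Rightarrow> real)"

definition preact :: "'n arch \<Rightarrow> 'n weights \<Rightarrow> real ^ 'n \<Rightarrow> (nat \<Rightarrow> nat \<Rightarrow> real) \<Rightarrow> 'n node \<Rightarrow> real" where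
  "preact A wh x V t =
     (\<Sum>i\<in>UNIV. if (In i, t) \<in> edges A then fst wh (In i, t) * x $ i else 0)
   + (\<Sum>l\<in>{1..depth A}. \<Sum>j<width A l.
        if (Hid l j, t) \<in> edges A then fst wh (Hid l j, t) * V l j else 0)
   + snd wh t"

text \<open>Outputs of all hidden units of layers 1..k (later layers set to 0).\<close>
primrec hidden_vals :: "'n arch \<Rightarrow> 'n weights \<Rightarrow> real ^ 'n \<Rightarrow> nat \<Rightarrow> nat \<Rightarrow> nat \<Rightarrow> real" where
  "hidden_vals A wh x 0 = (\<lambda>l j. 0)"
| "hidden_vals A wh x (Suc k) =
     (\<lambda>l j. if l = Suc k then max 0 (preact A wh x (hidden_vals A wh x k) (Hid l j))
            else hidden_vals A wh x k l j)"

definition net_fun :: "'n arch \<Rightarrow> 'n weights \<Rightarrow> real ^ 'n \<Rightarrow> real" where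
  "net_fun A wh x = preact A wh x (hidden_vals A wh x (depth A)) Out"

definition rate_achieved ::
  "real \<Rightarrow> (nat \<Rightarrow> 'n arch) \<Rightarrow> (nat \<Rightarrow> (real ^ 'n \<Rightarrow> real) \<Rightarrow> 'n weights) \<Rightarrow> bool" where
  "rate_achieved p archs assign =
    ((\<forall>W>0. wf_arch (archs W) \<and> num_weights (archs W) = W) \<and>
     (\<exists>a c::real. c > 0 \<and>
        (\<forall>f W. continuous_on unit_cube f \<longrightarrow> W > 0 \<longrightarrow>
           sup_dist f (net_fun (archs W) (assign W f)) \<le> a * modcont f (c * real W powr (- p)))))"

definition continuous_assign ::
  "(nat \<Rightarrow> 'n arch) \<Rightarrow> (nat \<Rightarrow> (real ^ 'n \<Rightarrow> real) \<Rightarrow> 'n weights) \<Rightarrow> bool" where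
  "continuous_assign archs assign =
    (\<forall>W>0. \<forall>f. continuous_on unit_cube f \<longrightarrow> (\<forall>\<epsilon>>0. \<exists>\<delta>>0. \<forall>g. continuous_on unit_cube g \<longrightarrow>
        sup_dist f g < \<delta> \<longrightarrow>
        (\<forall>e\<in>edges (archs W). \<bar>fst (assign W f) e - fst (assign W g) e\<bar> < \<epsilon>) \<and>
        (\<forall>u. (is_hidden (archs W) u \<or> u = Out) \<longrightarrow>
             \<bar>snd (assign W f) u - snd (assign W g) u\<bar> < \<epsilon>)))"

end

theory Submission
  imports Defs "HOL-Real_Asymp.Real_Asymp"
begin

text \<open>If the rate with power \<open>p\<close> is achieved, then for a grid of \<open>m\<close> points of spacing \<open>1 / n\<close>, with
  \<open>m = n ^ \<nu>\<close> of order \<open>W powr (p * \<nu>)\<close>, the networks approximate all sums of \<open>m\<close> Lipschitz bumps of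
  height \<open>h * z r\<close>, \<open>\<bar>z r\<bar> \<le> 1\<close>, with error at most \<open>h / 4\<close> at the grid points.

  Taking all sign vectors \<open>z\<close>, the network realises \<open>2 ^ m\<close> sign patterns on the grid. On each cell of
  constant activation pattern the network is polynomial in its weights, so a layerwise count bounds the
  number of patterns by \<open>(2 * m * W\<^sup>2 + 1) ^ (W * (L + 1))\<close>. Hence \<open>m\<close> is at most of order
  \<open>W * (L + 1) * ln W\<close>, which gives the depth bound (c), and (a) because \<open>L < W\<close>.

  If the weights depend continuously on \<open>f\<close>, the grid values of the network depend continuously on
  \<open>z\<close> and stay close to \<open>h * z\<close>, so they come arbitrarily near every point of a cube in \<open>m\<close> dimensions.
  For fixed \<open>W\<close> and \<open>T\<close> thresholds this realises \<open>T ^ m\<close> patterns, whereas the count allows only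
  \<open>O(T ^ W)\<close>; thus \<open>m \<le> W\<close>, which is (b).\<close>

section \<open>Sign patterns of polynomials\<close>

text \<open>Polynomials are treated as functions closed under sums and products, so networks can be
  recognised as polynomial without computing coefficients. The index \<open>d\<close> is only an
  upper bound for the degree, and \<open>I\<close> contains all variables that occur.\<close>

inductive polyfun :: "'v set \<Rightarrow> nat \<Rightarrow> (('v \<Rightarrow> real) \<Rightarrow> real) \<Rightarrow> bool" for I where
  const: "polyfun I d (\<lambda>x. c)"
| var: "i \<in> I \<Longrightarrow> polyfun I (Suc d) (\<lambda>x. x i)"
| add: "polyfun I d f \<Longrightarrow> polyfun I d g \<Longrightarrow> polyfun I d (\<lambda>x. f x + g x)"
| mult: "polyfun I a f \<Longrightarrow> polyfun I b g \<Longrightarrow> polyfun I (a + b) (\<lambda>x. f x * g x)"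

lemma polyfun_mono:
  assumes "polyfun I d f" "d \<le> e"
  shows "polyfun I e f"
  using assms
proof (induction arbitrary: e rule: polyfun.induct)
  case (const d c)
  show ?case by (rule polyfun.const)
next
  case (var i d)
  then show ?case by (cases e) (auto intro: polyfun.var)
next
  case (add d f g)
  then show ?case by (auto intro: polyfun.add)
next
  case (mult a f b g)
  have "polyfun I (a + (e - a)) (\<lambda>x. f x * g x)"
    by (rule polyfun.mult) (use mult in auto)
  with mult show ?case by simp
qed

lemma polyfun_sum:
  assumes "\<And>j. j \<in> J \<Longrightarrow> polyfun I d (f j)"
  shows "polyfun I d (\<lambda>x. \<Sum>j\<in>J. f j x)"
  using assms
  by (induction J rule: infinite_finite_induct) (auto intro: polyfun.const polyfun.add)

lemma polyfun_prod:
  assumes "finite J" "\<And>j. j \<in> J \<Longrightarrow> polyfun I d (f j)"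
  shows "polyfun I (card J * d) (\<lambda>x. \<Prod>j\<in>J. f j x)"
  using assms
  by (induction J rule: finite_induct) (auto intro: polyfun.const polyfun.mult)

lemma polyfun_power: "polyfun I d f \<Longrightarrow> polyfun I (n * d) (\<lambda>x. f x ^ n)"
  by (induction n) (auto intro: polyfun.const polyfun.mult)

lemma polyfun_continuous: "polyfun I d f \<Longrightarrow> continuous_on UNIV f"
proof (induction rule: polyfun.induct)
  case (var i d)
  show ?case by (rule continuous_on_product_coordinates)
qed (auto intro: continuous_intros)

text \<open>Induction with the sum and product rules. The degree bound is not lowered by one; the
  later count of solutions only asks for a degree below the exponent \<open>N\<close>.\<close>

lemma polyfun_partial_derivative:
  assumes "polyfun I d f"
  shows "\<exists>g. polyfun I d g \<and> (\<forall>x. ((\<lambda>t. f (x(i := t))) has_real_derivative g x) (at (x i)))"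
  using assms
proof (induction rule: polyfun.induct)
  case (const d c)
  show ?case by (intro exI[of _ "\<lambda>x. 0"]) (auto intro: polyfun.const)
next
  case (var j d)
  show ?case
    by (intro exI[of _ "\<lambda>x. if j = i then 1 else 0"]) (auto intro: polyfun.const)
next
  case (add d f g)
  then obtain f' g' where
    "polyfun I d f'" "\<forall>x. ((\<lambda>t. f (x(i := t))) has_real_derivative f' x) (at (x i))"
    "polyfun I d g'" "\<forall>x. ((\<lambda>t. g (x(i := t))) has_real_derivative g' x) (at (x i))"
    by blast
  then show ?case
    by (intro exI[of _ "\<lambda>x. f' x + g' x"] conjI allI polyfun.add DERIV_add) blast+
next
  case (mult a f b g)
  then obtain f' g' where
    *: "polyfun I a f'" "\<forall>x. ((\<lambda>t. f (x(i := t))) has_real_derivative f' x) (at (x i))"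
    "polyfun I b g'" "\<forall>x. ((\<lambda>t. g (x(i := t))) has_real_derivative g' x) (at (x i))"
    by blast
  have "polyfun I (a + b) (\<lambda>x. f' x * g x + f x * g' x)"
    using * mult.hyps by (auto intro: polyfun.add polyfun.mult)
  moreover have "((\<lambda>t. f (x(i := t)) * g (x(i := t))) has_real_derivative
      f' x * g x + f x * g' x) (at (x i))" for x
    using DERIV_mult[OF *(2)[rule_format, of x] *(4)[rule_format, of x]]
    by (simp add: mult.commute add.commute)
  ultimately show ?case by (intro exI[of _ "\<lambda>x. f' x * g x + f x * g' x"]) blast
qed

text \<open>Serves to confine the set where a polynomial minus a penalty of higher degree is
  positive.\<close>

lemma polyfun_growth:
  assumes "polyfun I d f"
  shows "\<exists>C. \<forall>x R. 1 \<le> R \<longrightarrow> (\<forall>i\<in>I. \<bar>x i\<bar> \<le> R) \<longrightarrow> \<bar>f x\<bar> \<le> C * R ^ d"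
  using assms
proof (induction rule: polyfun.induct)
  case (const d c)
  have "\<bar>c\<bar> * 1 \<le> \<bar>c\<bar> * R ^ d" if "1 \<le> R" for R :: real
    using that by (intro mult_left_mono) auto
  then show ?case by (intro exI[of _ "\<bar>c\<bar>"]) auto
next
  case (var i d)
  have "\<bar>x i\<bar> \<le> 1 * R ^ Suc d" if "1 \<le> R" "\<bar>x i\<bar> \<le> R" for R and x :: "_ \<Rightarrow> real"
    using that self_le_power[of R "Suc d"] by (simp del: power_Suc)
  then show ?case using var by (intro exI[of _ 1]) blast
next
  case (add d f g)
  then obtain C C' where C: "\<And>x R. 1 \<le> R \<Longrightarrow> (\<forall>i\<in>I. \<bar>x i\<bar> \<le> R) \<Longrightarrow> \<bar>f x\<bar> \<le> C * R ^ d"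
    "\<And>x R. 1 \<le> R \<Longrightarrow> (\<forall>i\<in>I. \<bar>x i\<bar> \<le> R) \<Longrightarrow> \<bar>g x\<bar> \<le> C' * R ^ d"
    by metis
  have "\<bar>f x + g x\<bar> \<le> (C + C') * R ^ d" if "1 \<le> R" "\<forall>i\<in>I. \<bar>x i\<bar> \<le> R" for x R
    using C(1)[OF that] C(2)[OF that] by (simp add: distrib_right)
  then show ?case by blast
next
  case (mult a f b g)
  then obtain C C' where C: "\<And>x R. 1 \<le> R \<Longrightarrow> (\<forall>i\<in>I. \<bar>x i\<bar> \<le> R) \<Longrightarrow> \<bar>f x\<bar> \<le> C * R ^ a"
    "\<And>x R. 1 \<le> R \<Longrightarrow> (\<forall>i\<in>I. \<bar>x i\<bar> \<le> R) \<Longrightarrow> \<bar>g x\<bar> \<le> C' * R ^ b"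
    by metis
  have "\<bar>f x * g x\<bar> \<le> (C * C') * R ^ (a + b)" if "1 \<le> R" "\<forall>i\<in>I. \<bar>x i\<bar> \<le> R" for x R
  proof -
    have "\<bar>f x\<bar> * \<bar>g x\<bar> \<le> (C * R ^ a) * (C' * R ^ b)"
      using C(1)[OF that] C(2)[OF that] by (intro mult_mono) auto
    then show ?thesis by (simp add: abs_mult power_add ac_simps)
  qed
  then show ?case by blast
qed

section \<open>Expansion into monomials\<close>

definition monomial :: "'v set \<Rightarrow> ('v \<Rightarrow> nat) \<Rightarrow> ('v \<Rightarrow> real) \<Rightarrow> real" where
  "monomial I \<alpha> x = (\<Prod>i\<in>I. x i ^ \<alpha> i)"

lemma polyfun_monomial:
  assumes "finite I"
  shows "polyfun I (\<Sum>i\<in>I. \<alpha> i) (monomial I \<alpha>)"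
proof -
  have "polyfun I (\<Sum>i\<in>J. \<alpha> i) (\<lambda>x. \<Prod>i\<in>J. x i ^ \<alpha> i)" if "finite J" "J \<subseteq> I" for J
    using that
  proof (induction rule: finite_induct)
    case empty
    show ?case by (simp add: polyfun.const)
  next
    case (insert i J)
    have "polyfun I (\<alpha> i * 1) (\<lambda>x. x i ^ \<alpha> i)"
      using insert polyfun.var[of i I 0] by (intro polyfun_power) auto
    with insert show ?case by (auto intro: polyfun.mult)
  qed
  then show ?thesis using assms unfolding monomial_def[abs_def] by auto
qed

text \<open>Linear combinations of monomials of total degree at most \<open>d\<close>. Unlike those
  of \<open>polyfun\<close>, these rules are linear, so statements about linear functionals can be
  proved by induction over them.\<close>

inductive monosum :: "'v set \<Rightarrow> nat \<Rightarrow> (('v \<Rightarrow> real) \<Rightarrow> real) \<Rightarrow> bool" for I where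
  mono: "(\<Sum>i\<in>I. \<alpha> i) \<le> d \<Longrightarrow> monosum I d (\<lambda>x. c * monomial I \<alpha> x)"
| add: "monosum I d f \<Longrightarrow> monosum I d g \<Longrightarrow> monosum I d (\<lambda>x. f x + g x)"

lemma monosum_mult:
  assumes "monosum I a f" "monosum I b g"
  shows "monosum I (a + b) (\<lambda>x. f x * g x)"
  using assms(1)
proof (induction rule: monosum.induct)
  case (mono \<alpha> a c)
  show ?case
    using assms(2)
  proof (induction rule: monosum.induct)
    case (mono \<beta> b c')
    have "monosum I (a + b) (\<lambda>x. (c * c') * monomial I (\<lambda>i. \<alpha> i + \<beta> i) x)"
      using mono \<open>sum \<alpha> I \<le> a\<close> by (intro monosum.mono) (auto simp: sum.distrib)
    also have "(\<lambda>x. (c * c') * monomial I (\<lambda>i. \<alpha> i + \<beta> i) x)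
        = (\<lambda>x. c * monomial I \<alpha> x * (c' * monomial I \<beta> x))"
      by (auto simp: monomial_def power_add prod.distrib)
    finally show ?case .
  next
    case (add d f g)
    then show ?case by (auto simp: distrib_left intro: monosum.add)
  qed
next
  case (add d f g)
  then show ?case by (auto simp: distrib_right intro: monosum.add)
qed

lemma polyfun_monosum:
  assumes "polyfun I d f" "finite I"
  shows "monosum I d f"
  using assms(1)
proof (induction rule: polyfun.induct)
  case (const d c)
  show ?case using monosum.mono[of "\<lambda>_. 0" I d c] by (simp add: monomial_def)
next
  case (var i d)
  have "monosum I (Suc d) (\<lambda>x. 1 * monomial I (\<lambda>j. if j = i then 1 else 0) x)"
    using var assms(2) by (intro monosum.mono) auto
  moreover have "monomial I (\<lambda>j. if j = i then 1 else 0) x = x i" for x :: "_ \<Rightarrow> real"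
    using var assms(2) by (simp add: monomial_def if_distrib cong: if_cong)
  ultimately show ?case by simp
qed (auto intro: monosum.add monosum_mult)

section \<open>Counting solutions of polynomial systems\<close>

text \<open>Gaussian elimination, by induction on the number of equations: an equation with a
  nonzero coefficient eliminates one unknown, which again leaves fewer equations than
  unknowns.\<close>

lemma homogeneous_system_nontrivial:
  fixes a :: "'e \<Rightarrow> 's \<Rightarrow> real"
  assumes "finite E" "finite S" "card E < card S"
  shows "\<exists>c. (\<exists>s\<in>S. c s \<noteq> 0) \<and> (\<forall>e\<in>E. (\<Sum>s\<in>S. c s * a e s) = 0)"
  using assms
proof (induction E arbitrary: S a rule: finite_induct)
  case empty
  then have "S \<noteq> {}" by auto
  then show ?case by (intro exI[of _ "\<lambda>_. 1"]) auto
next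
  case (insert e E)
  show ?case
  proof (cases "\<forall>s\<in>S. a e s = 0")
    case True
    have "card E < card S" using insert by simp
    then obtain c where "\<exists>s\<in>S. c s \<noteq> 0" "\<forall>e\<in>E. (\<Sum>s\<in>S. c s * a e s) = 0"
      using insert.IH[OF insert.prems(1)] by blast
    with True show ?thesis by (intro exI[of _ c]) auto
  next
    case False
    then obtain s0 where s0: "s0 \<in> S" "a e s0 \<noteq> 0" by auto
    let ?S = "S - {s0}"
    have "card E < card ?S" using insert s0 by simp
    then obtain c where c: "\<exists>s\<in>?S. c s \<noteq> 0"
      "\<forall>e'\<in>E. (\<Sum>s\<in>?S. c s * (a e' s - a e s / a e s0 * a e' s0)) = 0"
      using insert.IH[of ?S "\<lambda>e' s. a e' s - a e s / a e s0 * a e' s0"] insert.prems by auto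
    \<comment> \<open>The value of the eliminated unknown, from solving equation \<open>e\<close>
      for it.\<close>
    define k where "k = - (\<Sum>s\<in>?S. c s * a e s) / a e s0"
    have "(\<Sum>s\<in>S. (c(s0 := k)) s * a e' s) = (\<Sum>s\<in>?S. c s * a e' s) + k * a e' s0" for e'
      using s0 insert.prems by (subst sum.remove[of S s0]) auto
    moreover have "(\<Sum>s\<in>?S. c s * a e' s) + k * a e' s0 = 0" if "e' \<in> insert e E" for e'
    proof (cases "e' = e")
      case True
      then show ?thesis using s0 by (simp add: k_def)
    next
      case False
      then have "(\<Sum>s\<in>?S. c s * (a e' s - a e s / a e s0 * a e' s0)) = 0" using c that by auto
      moreover have "(\<Sum>s\<in>?S. c s * (a e' s - a e s / a e s0 * a e' s0))
        = (\<Sum>s\<in>?S. c s * a e' s) + k * a e' s0"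
        by (simp add: k_def right_diff_distrib sum_subtractf sum_distrib_left sum_divide_distrib
            mult_ac)
      ultimately show ?thesis by simp
    qed
    moreover have "\<exists>s\<in>S. (c(s0 := k)) s \<noteq> 0" using c by auto
    ultimately show ?thesis by (intro exI[of _ "c(s0 := k)"]) auto
  qed
qed

text \<open>Modulo the system, every polynomial restricted to the solution set is a combination of the
  \<open>N ^ card I\<close> monomials with all exponents below \<open>N\<close>, whereas the polynomials separate the points of
  any finite set.\<close>
lemma card_solutions_le:
  fixes q :: "'v \<Rightarrow> ('v \<Rightarrow> real) \<Rightarrow> real"
  assumes "finite I" "finite S"
    and supp: "\<And>x i. x \<in> S \<Longrightarrow> i \<notin> I \<Longrightarrow> x i = 0"
    and deg: "\<And>i. i \<in> I \<Longrightarrow> polyfun I d (q i)" and "d < N"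
    and sol: "\<And>x i. x \<in> S \<Longrightarrow> i \<in> I \<Longrightarrow> x i ^ N = q i x"
  shows "card S \<le> N ^ card I"
proof (rule ccontr)
  assume "\<not> ?thesis"
  define E where "E = (\<Pi>\<^sub>E i\<in>I. {..<N})"
  have "finite E" "card E = N ^ card I"
    using \<open>finite I\<close> by (auto simp: E_def finite_PiE card_PiE)
  with \<open>\<not> ?thesis\<close> obtain c where c: "\<exists>s\<in>S. c s \<noteq> 0"
    "\<forall>\<alpha>\<in>E. (\<Sum>s\<in>S. c s * monomial I \<alpha> s) = 0"
    using homogeneous_system_nontrivial[of E S "monomial I"] \<open>finite S\<close> by auto
  \<comment> \<open>A nontrivial functional that kills all monomials with exponents in
    \<open>E\<close>; it will turn out to kill every polynomial.\<close>
  define \<Lambda> where "\<Lambda> f = (\<Sum>s\<in>S. c s * f s)" for f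
  have step: "\<Lambda> f = 0" if "polyfun I e f" "\<And>\<alpha>. sum \<alpha> I \<le> e \<Longrightarrow> \<Lambda> (monomial I \<alpha>) = 0" for f e
    using polyfun_monosum[OF that(1) \<open>finite I\<close>] that(2)
  proof (induction rule: monosum.induct)
    case (mono \<alpha> d c')
    have "\<Lambda> (\<lambda>x. c' * monomial I \<alpha> x) = c' * \<Lambda> (monomial I \<alpha>)"
      by (simp add: \<Lambda>_def sum_distrib_left ac_simps)
    with mono show ?case by simp
  next
    case (add d f g)
    have "\<Lambda> (\<lambda>x. f x + g x) = \<Lambda> f + \<Lambda> g"
      by (simp add: \<Lambda>_def distrib_left sum.distrib)
    with add show ?case by simp
  qed
  \<comment> \<open>Induction on the total degree: on \<open>S\<close> a factor
    \<open>x i ^ N\<close> may be replaced by \<open>q i x\<close>, which lowers the degree because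
    \<open>d < N\<close>.\<close>
  have mono0: "\<Lambda> (monomial I \<alpha>) = 0" for \<alpha>
  proof (induction "sum \<alpha> I" arbitrary: \<alpha> rule: less_induct)
    case less
    show ?case
    proof (cases "\<forall>i\<in>I. \<alpha> i < N")
      case True
      then have "restrict \<alpha> I \<in> E" by (auto simp: E_def)
      with c(2) have "\<Lambda> (monomial I (restrict \<alpha> I)) = 0" by (auto simp: \<Lambda>_def)
      then show ?thesis by (simp add: monomial_def[abs_def] cong: prod.cong)
    next
      case False
      then obtain i where i: "i \<in> I" "N \<le> \<alpha> i" by force
      define \<beta> where "\<beta> = \<alpha>(i := \<alpha> i - N)"
      have sums: "sum \<alpha> I = \<alpha> i + sum \<alpha> (I - {i})" "sum \<beta> I = (\<alpha> i - N) + sum \<alpha> (I - {i})"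
        using i \<open>finite I\<close> by (simp_all add: sum.remove[of I i] \<beta>_def)
      define f where "f x = monomial I \<beta> x * q i x" for x
      have pf: "polyfun I (sum \<beta> I + d) f"
        unfolding f_def using polyfun_monomial[OF \<open>finite I\<close>] deg[OF i(1)] by (rule polyfun.mult)
      have "sum \<beta> I + d < sum \<alpha> I" using sums i \<open>d < N\<close> by linarith
      then have "\<Lambda> f = 0" by (intro step[OF pf] less) auto
      moreover have "monomial I \<alpha> x = f x" if "x \<in> S" for x
      proof -
        have "monomial I \<alpha> x = x i ^ \<alpha> i * (\<Prod>j\<in>I - {i}. x j ^ \<alpha> j)"
          using i \<open>finite I\<close> by (simp add: monomial_def prod.remove[of I i])
        also have "x i ^ \<alpha> i = x i ^ (\<alpha> i - N) * q i x"
          using i power_add[of "x i" "\<alpha> i - N" N] sol[OF that i(1)] by simp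
        finally show ?thesis
          using i \<open>finite I\<close> by (simp add: f_def monomial_def \<beta>_def prod.remove[of I i])
      qed
      ultimately show ?thesis by (simp add: \<Lambda>_def)
    qed
  qed
  have \<Lambda>0: "\<Lambda> f = 0" if "polyfun I e f" for f e
    using step[OF that] mono0 by blast
  obtain s0 where s0: "s0 \<in> S" "c s0 \<noteq> 0" using c(1) by auto
  \<comment> \<open>This polynomial vanishes on \<open>S\<close> except at \<open>s0\<close>, so
    \<open>\<Lambda> f\<close> reduces to a single nonzero term.\<close>
  define f where "f x = (\<Prod>s\<in>S - {s0}. (\<Sum>i\<in>I. (x i - s i)\<^sup>2))" for x :: "'v \<Rightarrow> real"
  have "polyfun I (card (S - {s0}) * (2 * 1)) f"
    unfolding f_def
  proof (intro polyfun_prod polyfun_sum polyfun_power)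
    fix s i assume "i \<in> I"
    then have "polyfun I 1 (\<lambda>x. x i + (- s i))"
      using polyfun.var[of i I 0] by (intro polyfun.add polyfun.const) auto
    then show "polyfun I 1 (\<lambda>x. x i - s i)" by simp
  qed (use \<open>finite S\<close> in auto)
  then have "\<Lambda> f = 0" by (rule \<Lambda>0)
  moreover have "f s = 0" if "s \<in> S - {s0}" for s
    unfolding f_def using that \<open>finite S\<close> by (intro prod_zero) (auto intro!: bexI[of _ s])
  then have "\<Lambda> f = c s0 * f s0"
    using s0 \<open>finite S\<close> by (simp add: \<Lambda>_def sum.remove[of S s0])
  moreover have "f s0 \<noteq> 0"
  proof -
    have "(\<Sum>i\<in>I. (s0 i - s i)\<^sup>2) \<noteq> 0" if "s \<in> S" "s \<noteq> s0" for s
    proof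
      assume "(\<Sum>i\<in>I. (s0 i - s i)\<^sup>2) = 0"
      then have "\<forall>i\<in>I. s0 i = s i" using \<open>finite I\<close> by (simp add: sum_nonneg_eq_0_iff)
      moreover have "\<forall>i. i \<notin> I \<longrightarrow> s0 i = s i" using supp[OF s0(1)] supp[OF that(1)] by metis
      ultimately have "s0 = s" by (intro ext) blast
      with that show False by simp
    qed
    then show ?thesis using \<open>finite S\<close> by (auto simp: f_def)
  qed
  ultimately show False using s0 by simp
qed

section \<open>Critical points and sign vectors\<close>

lemma compact_box_fun:
  "compact {x :: 'v \<Rightarrow> real. \<forall>i. x i \<in> (if i \<in> I then {-R..R} else {0})}"
proof -
  have "compactin (product_topology (\<lambda>i. euclidean) UNIV)
    (PiE UNIV (\<lambda>i::'v. if i \<in> I then {-R..R::real} else {0}))"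
    by (subst compactin_PiE) auto
  moreover have "PiE UNIV (\<lambda>i::'v. if i \<in> I then {-R..R::real} else {0})
     = {x. \<forall>i. x i \<in> (if i \<in> I then {-R..R} else {0})}"
    by (auto simp: PiE_def Pi_def)
  ultimately show ?thesis
    by (simp add: euclidean_product_topology[symmetric] flip: compactin_euclidean_iff)
qed

text \<open>Each realised sign vector of the \<open>f j\<close> is realised at a critical point of
  \<open>P\<^sup>2 - \<epsilon> * (\<Sum>i\<in>I. x i ^ (2 * D))\<close>, where \<open>P\<close> is the product of the \<open>f j\<close> and
  \<open>2 * D > degree (P\<^sup>2)\<close>; these critical points solve a system as in \<open>card_solutions_le\<close>.\<close>
lemma card_strict_sign_points:
  fixes f :: "'j \<Rightarrow> ('v \<Rightarrow> real) \<Rightarrow> real"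
  assumes "finite I" "finite J" "finite S"
    and deg: "\<And>j. j \<in> J \<Longrightarrow> polyfun I d (f j)"
    and supp: "\<And>x i. x \<in> S \<Longrightarrow> i \<notin> I \<Longrightarrow> x i = 0"
    and nz: "\<And>x j. x \<in> S \<Longrightarrow> j \<in> J \<Longrightarrow> f j x \<noteq> 0"
    and inj: "inj_on (\<lambda>x. {j \<in> J. f j x > 0}) S"
  shows "card S \<le> (2 * card J * d + 1) ^ card I"
proof (cases "S = {}")
  case False
  define D where "D = card J * d + 1"
  define P where "P x = (\<Prod>j\<in>J. f j x)" for x
  have degP: "polyfun I (2 * (card J * d)) (\<lambda>x. P x ^ 2)"
    unfolding P_def by (intro polyfun_power polyfun_prod deg \<open>finite J\<close>)
  have contP: "continuous_on UNIV (\<lambda>x. P x ^ 2)" by (rule polyfun_continuous[OF degP])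
  have contf: "continuous_on UNIV (f j)" if "j \<in> J" for j
    using polyfun_continuous[OF deg[OF that]] .
  define Z where "Z x = (\<Sum>i\<in>I. x i ^ (2 * D))" for x :: "'v \<Rightarrow> real"
  have Z_nonneg: "0 \<le> Z x" for x unfolding Z_def by (intro sum_nonneg) auto
  have contZ: "continuous_on UNIV Z"
    unfolding Z_def by (intro continuous_intros continuous_on_product_coordinates)
  have Ppos: "0 < P x ^ 2" if "x \<in> S" for x
    using that nz \<open>finite J\<close> by (simp add: P_def)
  \<comment> \<open>Small enough for \<open>G\<close>, defined below, to be positive on all of
    \<open>S\<close>; the \<open>+ 1\<close> keeps the denominators positive.\<close>
  obtain \<epsilon> where \<epsilon>: "0 < \<epsilon>" "\<And>x. x \<in> S \<Longrightarrow> \<epsilon> * Z x < P x ^ 2"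
  proof
    let ?\<epsilon> = "Min ((\<lambda>x. P x ^ 2 / (Z x + 1)) ` S)"
    have *: "0 < P x ^ 2 / (Z x + 1)" if "x \<in> S" for x
      using Ppos[OF that] Z_nonneg[of x] by (intro divide_pos_pos) auto
    show "0 < ?\<epsilon>" using * False \<open>finite S\<close> by (subst Min_gr_iff) auto
    fix x assume x: "x \<in> S"
    have "?\<epsilon> \<le> P x ^ 2 / (Z x + 1)" using x \<open>finite S\<close> by (intro Min_le) auto
    then have "?\<epsilon> * (Z x + 1) \<le> P x ^ 2"
      using Z_nonneg[of x] by (simp add: pos_le_divide_eq)
    with \<open>0 < ?\<epsilon>\<close> show "?\<epsilon> * Z x < P x ^ 2" by (simp add: distrib_left)
  qed
  define G where "G x = P x ^ 2 - \<epsilon> * Z x" for x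
  have contG: "continuous_on UNIV G"
    unfolding G_def by (intro continuous_intros contP contZ)
  obtain C where C: "\<And>x R. 1 \<le> R \<Longrightarrow> (\<forall>i\<in>I. \<bar>x i\<bar> \<le> R) \<Longrightarrow> \<bar>P x ^ 2\<bar> \<le> C * R ^ (2 * (card J * d))"
    using polyfun_growth[OF degP] by blast
  \<comment> \<open>The degree of the penalty exceeds the degree bound of \<open>P x ^ 2\<close> by
    two: if the largest coordinate has size \<open>R > 1\<close>, positivity of \<open>G\<close>
    forces \<open>\<epsilon> * R ^ 2 < C\<close>, hence \<open>R < C / \<epsilon>\<close>.\<close>
  define B where "B = max 1 (C / \<epsilon>)"
  have B: "\<bar>x i\<bar> \<le> B" if Gx: "0 < G x" and "i \<in> I" for x i
  proof (rule ccontr)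
    assume "\<not> ?thesis"
    define R where "R = Max ((\<lambda>i. \<bar>x i\<bar>) ` I)"
    have ub: "\<forall>i\<in>I. \<bar>x i\<bar> \<le> R" unfolding R_def using \<open>finite I\<close> by auto
    with \<open>\<not> ?thesis\<close> \<open>i \<in> I\<close> have R: "1 < R" "C / \<epsilon> < R" by (force simp: B_def)+
    have "R \<in> (\<lambda>i. \<bar>x i\<bar>) ` I"
      unfolding R_def using \<open>finite I\<close> \<open>i \<in> I\<close> by (intro Max_in) auto
    then obtain k where k: "k \<in> I" "R = \<bar>x k\<bar>" by auto
    have "R ^ (2 * D) = x k ^ (2 * D)" using k by (simp add: power_even_abs)
    also have "\<dots> \<le> Z x" unfolding Z_def using k \<open>finite I\<close> by (intro member_le_sum) auto
    finally have "\<epsilon> * R ^ (2 * D) \<le> \<epsilon> * Z x" using \<epsilon>(1) by simp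
    also have "\<dots> < P x ^ 2" using Gx by (simp add: G_def)
    also have "\<dots> \<le> C * R ^ (2 * (card J * d))" using C[OF _ ub] R(1) by simp
    also have "2 * D = 2 * (card J * d) + 2" by (simp add: D_def)
    finally have "R ^ (2 * (card J * d)) * (\<epsilon> * R ^ 2) < R ^ (2 * (card J * d)) * C"
      by (simp add: power_add ac_simps power2_eq_square)
    then have "\<epsilon> * R ^ 2 < C" using R(1) by (subst (asm) mult_less_cancel_left_pos) auto
    moreover have "C < \<epsilon> * R" using R(2) \<epsilon>(1) by (simp add: field_simps)
    moreover have "\<epsilon> * R \<le> \<epsilon> * R ^ 2"
      using R(1) \<epsilon>(1) by (intro mult_left_mono) (auto simp: power2_eq_square)
    ultimately show False by linarith
  qed
  have "\<exists>g. polyfun I (2 * (card J * d)) g \<and>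
     (\<forall>x. ((\<lambda>t. P (x(i := t)) ^ 2) has_real_derivative g x) (at (x i)))" for i
    by (rule polyfun_partial_derivative[OF degP])
  then obtain g where g: "\<And>i. polyfun I (2 * (card J * d)) (g i)"
     "\<And>i x. ((\<lambda>t. P (x(i := t)) ^ 2) has_real_derivative g i x) (at (x i))"
    by metis
  have crit: "\<exists>y. (\<forall>i. i \<notin> I \<longrightarrow> y i = 0) \<and> (\<forall>j\<in>J. f j x * f j y > 0) \<and>
      (\<forall>i\<in>I. g i y = \<epsilon> * (real (2 * D) * y i ^ (2 * D - 1)))" if x: "x \<in> S" for x
  proof -
    \<comment> \<open>Weak inequalities make \<open>K\<close> compact. At a maximiser
      \<open>G\<close> is still positive, so no \<open>f j\<close> vanishes there and the sign
      conditions become strict.\<close>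
    define K where "K = {y. \<forall>i. y i \<in> (if i \<in> I then {-B..B} else {0})} \<inter> {y. \<forall>j\<in>J. 0 \<le> f j x * f j y}"
    have "closed {y. \<forall>j\<in>J. 0 \<le> f j x * f j y}"
    proof -
      have "closed {y. 0 \<le> f j x * f j y}" if "j \<in> J" for j
        by (intro closed_Collect_le continuous_intros contf that)
      moreover have "{y. \<forall>j\<in>J. 0 \<le> f j x * f j y} = (\<Inter>j\<in>J. {y. 0 \<le> f j x * f j y})" by auto
      ultimately show ?thesis by auto
    qed
    then have "compact K" unfolding K_def by (intro compact_Int_closed compact_box_fun)
    have inK: "y \<in> K" if "\<And>i. i \<notin> I \<Longrightarrow> y i = 0" "\<forall>j\<in>J. 0 < f j x * f j y" "0 < G y" for y
    proof -
      have "y i \<in> (if i \<in> I then {-B..B} else {0})" for i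
        using B[OF that(3), of i] that(1)[of i] by (auto simp: abs_le_iff)
      moreover have "\<forall>j\<in>J. 0 \<le> f j x * f j y" using that(2) by (simp add: less_imp_le)
      ultimately show ?thesis by (simp add: K_def)
    qed
    have Gx: "0 < G x" using \<epsilon>(2)[OF x] by (simp add: G_def)
    have "x \<in> K"
    proof (rule inK)
      show "\<forall>j\<in>J. 0 < f j x * f j x"
        using nz[OF x] by (simp add: zero_less_mult_iff linorder_neq_iff disj_commute)
    qed (use supp[OF x] Gx in auto)
    then obtain y where y: "y \<in> K" "\<And>z. z \<in> K \<Longrightarrow> G z \<le> G y"
      using continuous_attains_sup[OF \<open>compact K\<close> _ continuous_on_subset[OF contG]] by blast
    have Gy: "0 < G y" using Gx y(2)[OF \<open>x \<in> K\<close>] by linarith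
    moreover have "0 \<le> \<epsilon> * Z y" using Z_nonneg[of y] \<epsilon>(1) by simp
    ultimately have "P y \<noteq> 0" by (auto simp: G_def)
    then have nzy: "f j y \<noteq> 0" if "j \<in> J" for j using that \<open>finite J\<close> by (auto simp: P_def)
    have sgn: "\<forall>j\<in>J. f j x * f j y > 0"
    proof
      fix j assume j: "j \<in> J"
      have "0 \<le> f j x * f j y" using y(1) j by (simp add: K_def)
      moreover have "f j x * f j y \<noteq> 0" using nz[OF x j] nzy[OF j] by simp
      ultimately show "f j x * f j y > 0" by (simp add: less_le)
    qed
    have y0: "\<And>i. i \<notin> I \<Longrightarrow> y i = 0" using y(1) by (auto simp: K_def split: if_splits)
    have "g i y = \<epsilon> * (real (2 * D) * y i ^ (2 * D - 1))" if i: "i \<in> I" for i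
    proof -
      \<comment> \<open>A small change of coordinate \<open>i\<close> preserves the strict
        conditions and so stays in \<open>K\<close>; thus \<open>y i\<close> is a local maximum
        point of a function of one variable.\<close>
      define U where "U = {t. (\<forall>j\<in>J. 0 < f j x * f j (y(i := t))) \<and> 0 < G (y(i := t))}"
      have upd: "continuous_on UNIV (\<lambda>t. y(i := t))"
      proof (rule continuous_on_coordinatewise_then_product)
        show "continuous_on UNIV (\<lambda>t. (y(i := t)) k)" for k
          by (cases "k = i") (simp_all add: continuous_intros)
      qed
      have "open U"
      proof -
        have "open {t. 0 < f j x * f j (y(i := t))}" if "j \<in> J" for j
          by (intro open_Collect_less continuous_intros continuous_on_compose2[OF contf[OF that] upd]) auto
        moreover have "open {t. 0 < G (y(i := t))}"
          by (intro open_Collect_less continuous_intros continuous_on_compose2[OF contG upd]) auto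
        moreover have "U = (\<Inter>j\<in>J. {t. 0 < f j x * f j (y(i := t))}) \<inter> {t. 0 < G (y(i := t))}"
          by (auto simp: U_def)
        ultimately show ?thesis using \<open>finite J\<close> by auto
      qed
      moreover have "y i \<in> U" using sgn Gy by (simp add: U_def)
      ultimately obtain r where r: "0 < r" "ball (y i) r \<subseteq> U" by (meson open_contains_ball)
      have "G (y(i := t)) \<le> G (y(i := y i))" if "\<bar>y i - t\<bar> < r" for t
      proof -
        have "t \<in> U" using that r by (auto simp: dist_real_def)
        then have "y(i := t) \<in> K" using y0 i by (intro inK) (auto simp: U_def)
        then show ?thesis using y(2) by simp
      qed
      moreover have "((\<lambda>t. G (y(i := t))) has_real_derivative
         g i y - \<epsilon> * (real (2 * D) * y i ^ (2 * D - 1))) (at (y i))"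
      proof -
        have "(\<lambda>t. Z (y(i := t))) = (\<lambda>t. t ^ (2 * D) + (\<Sum>k\<in>I - {i}. y k ^ (2 * D)))"
          using i \<open>finite I\<close> by (auto simp: Z_def sum.remove[of I i])
        moreover have "((\<lambda>t. t ^ (2 * D) + (\<Sum>k\<in>I - {i}. y k ^ (2 * D))) has_real_derivative
            real (2 * D) * y i ^ (2 * D - 1)) (at (y i))"
          by (auto intro!: derivative_eq_intros)
        ultimately show ?thesis
          unfolding G_def using g(2)[of y i] by (auto intro!: DERIV_diff DERIV_cmult)
      qed
      ultimately have "g i y - \<epsilon> * (real (2 * D) * y i ^ (2 * D - 1)) = 0"
        using DERIV_local_max[OF _ r(1)] by blast
      then show ?thesis by simp
    qed
    then show ?thesis using y0 sgn by (intro exI[of _ y] conjI allI impI ballI) simp_all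
  qed
  then obtain Y where Y: "\<And>x i. x \<in> S \<Longrightarrow> i \<notin> I \<Longrightarrow> Y x i = 0"
     "\<And>x j. x \<in> S \<Longrightarrow> j \<in> J \<Longrightarrow> f j x * f j (Y x) > 0"
     "\<And>x i. x \<in> S \<Longrightarrow> i \<in> I \<Longrightarrow> g i (Y x) = \<epsilon> * (real (2 * D) * Y x i ^ (2 * D - 1))"
    by metis
  have "inj_on Y S"
  proof (rule inj_onI)
    fix x x' assume *: "x \<in> S" "x' \<in> S" "Y x = Y x'"
    have "0 < f j x \<longleftrightarrow> 0 < f j x'" if "j \<in> J" for j
      using Y(2)[OF *(1) that] Y(2)[OF *(2) that] *(3) by (auto simp: zero_less_mult_iff)
    then have "{j \<in> J. f j x > 0} = {j \<in> J. f j x' > 0}" by auto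
    then show "x = x'" using inj * by (auto dest: inj_onD)
  qed
  then have "card S = card (Y ` S)" by (simp add: card_image)
  also have "\<dots> \<le> (2 * card J * d + 1) ^ card I"
  \<comment> \<open>The critical equation is solved for its leading power, with
    \<open>N = 2 * D - 1\<close>, one more than the degree bound of the right-hand side.\<close>
  proof (rule card_solutions_le[where q = "\<lambda>i x. inverse (\<epsilon> * real (2 * D)) * g i x"])
    show "polyfun I (2 * card J * d) (\<lambda>x. inverse (\<epsilon> * real (2 * D)) * g i x)" if "i \<in> I" for i
      using polyfun.mult[OF polyfun.const[of _ 0] g(1)[of i], of "inverse (\<epsilon> * real (2 * D))"]
      by (simp add: mult.assoc)
    fix y i assume "y \<in> Y ` S" "i \<in> I"
    then have "g i y = (\<epsilon> * real (2 * D)) * y i ^ (2 * D - 1)" using Y(3) by auto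
    moreover have "0 < D" by (simp add: D_def)
    then have "\<epsilon> * real (2 * D) \<noteq> 0" using \<epsilon>(1) by simp
    moreover have "2 * D - 1 = 2 * card J * d + 1" by (simp add: D_def)
    ultimately show "y i ^ (2 * card J * d + 1) = inverse (\<epsilon> * real (2 * D)) * g i y"
      by (simp add: field_simps)
  qed (use assms Y(1) in auto)
  finally show ?thesis .
qed simp

text \<open>Reduction to nonvanishing values: with one representative point per pattern, every
  \<open>f j\<close> is shifted down by a \<open>\<delta>\<close> below all positive values that
  occur. Positive values stay positive, and values at most zero become negative.\<close>

lemma card_sign_patterns_le:
  fixes f :: "'j \<Rightarrow> ('v \<Rightarrow> real) \<Rightarrow> real"
  assumes "finite I" "finite J"
    and deg: "\<And>j. j \<in> J \<Longrightarrow> polyfun I d (f j)"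
  shows "card (range (\<lambda>x. {j \<in> J. f j x > 0})) \<le> (2 * card J * d + 1) ^ card I"
proof -
  define pat where "pat x = {j \<in> J. f j x > 0}" for x
  \<comment> \<open>The \<open>f j\<close> depend only on variables in \<open>I\<close>, so
    representatives can be chosen to vanish outside \<open>I\<close>, as the count of points
    demands.\<close>
  define trunc where "trunc x = (\<lambda>i. if i \<in> I then x i else 0)" for x :: "'v \<Rightarrow> real"
  have "f j (trunc x) = f j x" if "j \<in> J" for j x
    using deg[OF that] by (induction rule: polyfun.induct) (auto simp: trunc_def)
  then have pat_trunc: "pat (trunc x) = pat x" for x by (auto simp: pat_def)
  have fin: "finite (range pat)"
    by (rule finite_subset[of _ "Pow J"]) (use \<open>finite J\<close> in \<open>auto simp: pat_def\<close>)
  have "\<exists>x. pat x = p \<and> (\<forall>i. i \<notin> I \<longrightarrow> x i = 0)" if "p \<in> range pat" for p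
  proof -
    from that obtain x where "pat (trunc x) = p" using pat_trunc by auto
    then show ?thesis by (intro exI[of _ "trunc x"]) (auto simp: trunc_def)
  qed
  then obtain X where X: "\<And>p. p \<in> range pat \<Longrightarrow> pat (X p) = p"
    "\<And>p i. p \<in> range pat \<Longrightarrow> i \<notin> I \<Longrightarrow> X p i = 0"
    by metis
  \<comment> \<open>The element 1 keeps the set nonempty, so that \<open>Min\<close> is meaningful
    even if no value is positive.\<close>
  define V where "V = insert 1 {f j (X p) | j p. j \<in> J \<and> p \<in> range pat \<and> f j (X p) > 0}"
  have "V \<subseteq> insert 1 ((\<lambda>(j, p). f j (X p)) ` (J \<times> range pat))" by (auto simp: V_def)
  then have "finite V" using fin \<open>finite J\<close> by (meson finite_SigmaI finite_imageI finite_insert finite_subset)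
  define \<delta> where "\<delta> = Min V / 2"
  have "0 < Min V" using \<open>finite V\<close> by (subst Min_gr_iff) (auto simp: V_def)
  then have "0 < \<delta>" by (simp add: \<delta>_def)
  have less: "\<delta> < f j (X p)" if "j \<in> J" "p \<in> range pat" "f j (X p) > 0" for j p
  proof -
    have "Min V \<le> f j (X p)" using that \<open>finite V\<close> by (intro Min_le) (auto simp: V_def)
    with \<open>0 < Min V\<close> show ?thesis by (simp add: \<delta>_def)
  qed
  have eq: "{j \<in> J. f j (X p) + (- \<delta>) > 0} = p" if "p \<in> range pat" for p
  proof -
    have "{j \<in> J. f j (X p) + (- \<delta>) > 0} = pat (X p)"
    proof -
      have "f j (X p) + (- \<delta>) > 0 \<longleftrightarrow> f j (X p) > 0" if "j \<in> J" for j
        using less[OF that \<open>p \<in> range pat\<close>] \<open>0 < \<delta>\<close> by auto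
      then show ?thesis by (auto simp: pat_def)
    qed
    then show ?thesis using X(1)[OF that] by simp
  qed
  have "card (range pat) = card (X ` range pat)"
    using X(1) by (intro card_image[symmetric]) (metis inj_onI)
  also have "\<dots> \<le> (2 * card J * d + 1) ^ card I"
  proof (rule card_strict_sign_points[where f = "\<lambda>j x. f j x + (- \<delta>)"])
    show "polyfun I d (\<lambda>x. f j x + (- \<delta>))" if "j \<in> J" for j
      using deg[OF that] by (intro polyfun.add polyfun.const)
    show "f j x + (- \<delta>) \<noteq> 0" if "x \<in> X ` range pat" "j \<in> J" for x j
    proof -
      from that obtain p where "p \<in> range pat" "x = X p" by blast
      with less[OF \<open>j \<in> J\<close>, of p] \<open>0 < \<delta>\<close> show ?thesis by (cases "0 < f j x") auto
    qed
    show "inj_on (\<lambda>x. {j \<in> J. f j x + (- \<delta>) > 0}) (X ` range pat)"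
    proof (rule inj_onI)
      fix x y
      assume "x \<in> X ` range pat" "y \<in> X ` range pat"
      then obtain p q where pq: "p \<in> range pat" "x = X p" "q \<in> range pat" "y = X q" by blast
      assume "{j \<in> J. f j x + (- \<delta>) > 0} = {j \<in> J. f j y + (- \<delta>) > 0}"
      with pq eq show "x = y" by simp
    qed
    show "x i = 0" if "x \<in> X ` range pat" "i \<notin> I" for x i
      using that X(2) by auto
  qed (use assms fin in auto)
  finally show ?thesis by (simp add: pat_def[abs_def])
qed

section \<open>Counting the patterns realised by a network\<close>

text \<open>The variables of the polynomials: \<open>Inl\<close> for connection weights,
  \<open>Inr\<close> for biases. Their number is \<open>num_weights A\<close>, which becomes the
  exponent in the pattern counts.\<close>

definition params :: "'n arch \<Rightarrow> (('n node \<times> 'n node) + 'n node) set" where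
  "params A = Inl ` edges A \<union> Inr ` {u. is_hidden A u \<or> u = Out}"

definition weights_of :: "(('n node \<times> 'n node) + 'n node \<Rightarrow> real) \<Rightarrow> 'n weights" where
  "weights_of \<theta> = (\<lambda>e. \<theta> (Inl e), \<lambda>u. \<theta> (Inr u))"

lemma surj_weights_of: "surj weights_of"
proof (rule surjI)
  show "weights_of (case_sum (fst wh) (snd wh)) = wh" for wh :: "'n weights"
    by (simp add: weights_of_def)
qed

lemma hidden_nodes_eq:
  "{u. is_hidden A u} = (\<lambda>(l, j). Hid l j) ` (SIGMA l:{1..depth A}. {..<width A l})"
proof (intro set_eqI iffI)
  fix u assume "u \<in> {u. is_hidden A u}"
  then show "u \<in> (\<lambda>(l, j). Hid l j) ` (SIGMA l:{1..depth A}. {..<width A l})"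
    by (cases u) (auto simp: is_hidden_def image_iff)
qed (auto simp: is_hidden_def)

lemma finite_hidden_nodes: "finite {u. is_hidden A u}"
  unfolding hidden_nodes_eq by auto

lemma card_hidden_nodes: "card {u. is_hidden A u} = (\<Sum>l=1..depth A. width A l)"
proof -
  have "inj_on (\<lambda>(l, j). Hid l j :: 'a node) X" for X
    by (auto simp: inj_on_def)
  then show ?thesis
    unfolding hidden_nodes_eq by (subst card_image) (auto simp: card_SigmaI)
qed

lemma finite_edges:
  fixes A :: "'n::finite arch"
  assumes "wf_arch A"
  shows "finite (edges A)"
proof (rule finite_subset)
  let ?N = "range In \<union> {u. is_hidden A u} \<union> {Out}"
  show "edges A \<subseteq> ?N \<times> ?N"
    using assms unfolding wf_arch_def by fast
  show "finite (?N \<times> ?N)"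
    using finite_hidden_nodes[of A] by (intro finite_cartesian_product) simp_all
qed

lemma
  fixes A :: "'n::finite arch"
  assumes "wf_arch A"
  shows finite_params: "finite (params A)"
    and card_params: "card (params A) = num_weights A"
proof -
  have *: "{u. is_hidden A u \<or> u = Out} = insert Out {u. is_hidden A u}" by auto
  have "\<not> is_hidden A Out" by (simp add: is_hidden_def)
  then have "card {u. is_hidden A u \<or> u = Out} = (\<Sum>l=1..depth A. width A l) + 1"
    unfolding * using finite_hidden_nodes[of A] card_hidden_nodes[of A] by simp
  moreover have fin: "finite (edges A)" "finite {u. is_hidden A u \<or> u = Out}"
    using finite_edges[OF assms] finite_hidden_nodes[of A] by (simp_all add: *)
  ultimately show "card (params A) = num_weights A"
    unfolding params_def num_weights_def
    by (subst card_Un_disjoint) (auto simp: card_image)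
  show "finite (params A)" using fin by (simp add: params_def)
qed

text \<open>By \<open>wf_arch\<close> every hidden layer has a unit; the output unit makes the
  inequality strict.\<close>

lemma depth_less_num_weights:
  assumes "wf_arch A"
  shows "depth A < num_weights A"
proof -
  have "(\<Sum>l=1..depth A. 1) \<le> (\<Sum>l=1..depth A. width A l)"
    using assms by (intro sum_mono) (auto simp: wf_arch_def)
  then show ?thesis by (simp add: num_weights_def)
qed

lemma width_less_num_weights:
  assumes "l \<in> {1..depth A}"
  shows "width A l < num_weights A"
proof -
  have "width A l \<le> (\<Sum>l=1..depth A. width A l)"
    using assms by (intro member_le_sum) auto
  then show ?thesis by (simp add: num_weights_def)
qed

section \<open>The network as a polynomial on each activation cell\<close>

lemma preact_cong:
  assumes "\<And>l j. l \<in> {1..depth A} \<Longrightarrow> j < width A l \<Longrightarrow> V l j = V' l j"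
  shows "preact A wh x V t = preact A wh x V' t"
  unfolding preact_def using assms by (intro arg_cong2[of _ _ _ _ "(+)"] sum.cong refl) auto

text \<open>A weight of degree one multiplies an incoming value of degree \<open>d\<close>, so
  passing one computation unit raises the degree by one.\<close>

lemma polyfun_preact:
  assumes t: "is_hidden A t \<or> t = Out"
    and V: "\<And>l j. l \<in> {1..depth A} \<Longrightarrow> j < width A l \<Longrightarrow> polyfun (params A) d (\<lambda>\<theta>. V \<theta> l j)"
  shows "polyfun (params A) (Suc d) (\<lambda>\<theta>. preact A (weights_of \<theta>) x (V \<theta>) t)"
proof -
  have edge: "polyfun (params A) (Suc e) (\<lambda>\<theta>. \<theta> (Inl (s, t)))" if "(s, t) \<in> edges A" for s e
    using that by (intro polyfun.var) (auto simp: params_def)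
  have bias: "polyfun (params A) (Suc d) (\<lambda>\<theta>. \<theta> (Inr t))"
    using t by (intro polyfun.var) (auto simp: params_def)
  have inp: "polyfun (params A) (Suc d)
     (\<lambda>\<theta>. if (In i, t) \<in> edges A then \<theta> (Inl (In i, t)) * x $ i else 0)" for i
  proof (cases "(In i, t) \<in> edges A")
    case True
    have "polyfun (params A) (Suc d + 0) (\<lambda>\<theta>. \<theta> (Inl (In i, t)) * x $ i)"
      using edge[OF True] polyfun.const by (rule polyfun.mult)
    with True show ?thesis by simp
  qed (simp add: polyfun.const)
  have hid: "polyfun (params A) (Suc d)
     (\<lambda>\<theta>. if (Hid l j, t) \<in> edges A then \<theta> (Inl (Hid l j, t)) * V \<theta> l j else 0)"
    if "l \<in> {1..depth A}" "j < width A l" for l j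
  proof (cases "(Hid l j, t) \<in> edges A")
    case True
    have "polyfun (params A) (Suc 0 + d) (\<lambda>\<theta>. \<theta> (Inl (Hid l j, t)) * V \<theta> l j)"
      using edge[OF True] V[OF that] by (rule polyfun.mult)
    with True show ?thesis by simp
  qed (simp add: polyfun.const)
  show ?thesis
    unfolding preact_def weights_of_def fst_conv snd_conv
    by (intro polyfun.add polyfun_sum inp hid bias) auto
qed

text \<open>On the weights with activation pattern \<open>act\<close> this is the network itself; for fixed \<open>act\<close> it is
  polynomial in the weights.\<close>
primrec gated_vals ::
  "'n arch \<Rightarrow> 'n weights \<Rightarrow> real ^ 'n \<Rightarrow> (nat \<times> nat) set \<Rightarrow> nat \<Rightarrow> nat \<Rightarrow> nat \<Rightarrow> real" where
  "gated_vals A wh x act 0 = (\<lambda>l j. 0)"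
| "gated_vals A wh x act (Suc k) =
     (\<lambda>l j. if l = Suc k
            then (if (l, j) \<in> act then preact A wh x (gated_vals A wh x act k) (Hid l j) else 0)
            else gated_vals A wh x act k l j)"

lemma polyfun_gated_vals:
  assumes "l \<in> {1..depth A}" "j < width A l"
  shows "polyfun (params A) k (\<lambda>\<theta>. gated_vals A (weights_of \<theta>) x act k l j)"
  using assms
proof (induction k arbitrary: l j)
  case 0
  show ?case by (simp add: polyfun.const)
next
  case (Suc k)
  show ?case
  proof (cases "l = Suc k \<and> (l, j) \<in> act")
    case True
    have "polyfun (params A) (Suc k)
        (\<lambda>\<theta>. preact A (weights_of \<theta>) x (gated_vals A (weights_of \<theta>) x act k) (Hid l j))"
      by (rule polyfun_preact) (use Suc in \<open>auto simp: is_hidden_def\<close>)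
    moreover have "(Suc k, j) \<in> act" using True by auto
    ultimately show ?thesis using True by simp
  next
    case False
    then show ?thesis
      using polyfun_mono[OF Suc.IH[OF Suc.prems], of "Suc k"] by (cases "l = Suc k") (auto intro: polyfun.const)
  qed
qed

text \<open>Induction over the layers: \<open>max 0\<close> is the identity on active units and zero
  on the others, so the gates reproduce the network when \<open>act\<close> records its own
  activity.\<close>

lemma gated_vals_eq_hidden_vals:
  assumes "\<And>l j. l \<in> {1..k} \<Longrightarrow> j < width A l \<Longrightarrow> (l, j) \<in> act \<longleftrightarrow> 0 < hidden_vals A wh x k l j"
    and "j < width A l"
  shows "gated_vals A wh x act k l j = hidden_vals A wh x k l j"
  using assms
proof (induction k arbitrary: l j)
  case 0
  show ?case by simp
next
  case (Suc k)
  have IH: "gated_vals A wh x act k l j = hidden_vals A wh x k l j" if "j < width A l" for l j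
  proof (rule Suc.IH[OF _ that])
    fix l j assume "l \<in> {1..k}" "j < width A l"
    with Suc.prems(1)[of l j] show "(l, j) \<in> act \<longleftrightarrow> 0 < hidden_vals A wh x k l j" by auto
  qed
  have "preact A wh x (gated_vals A wh x act k) u = preact A wh x (hidden_vals A wh x k) u" for u
    by (rule preact_cong) (use IH in auto)
  moreover have "(l, j) \<in> act \<longleftrightarrow> 0 < hidden_vals A wh x (Suc k) l j" if "l = Suc k"
    using Suc.prems that by auto
  ultimately show ?case using IH Suc.prems(2) by auto
qed

section \<open>Counting patterns layer by layer\<close>

text \<open>Values of \<open>Q\<close> are counted on each fibre of \<open>F\<close>. In the
  applications \<open>F\<close> is the activation pattern of earlier layers, and on its fibres the
  remaining signs come from polynomials.\<close>

lemma card_range_fibres_le: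
  assumes "finite (range F)" "\<And>w. finite (Q ` {v. F v = F w})" "\<And>w. card (Q ` {v. F v = F w}) \<le> B"
  shows "finite (range Q)" "card (range Q) \<le> card (range F) * B"
proof -
  have eq: "range Q = (\<Union>a\<in>range F. Q ` {v. F v = a})" by auto
  show "finite (range Q)" unfolding eq using assms(1,2) by (intro finite_UN_I) auto
  have "card (range Q) \<le> (\<Sum>a\<in>range F. card (Q ` {v. F v = a}))"
    unfolding eq by (rule card_UN_le[OF assms(1)])
  also have "\<dots> \<le> (\<Sum>a\<in>range F. B)" using assms(3) by (intro sum_mono) auto
  finally show "card (range Q) \<le> card (range F) * B" by simp
qed

definition active_units ::
  "'n arch \<Rightarrow> (nat \<Rightarrow> real ^ 'n) \<Rightarrow> nat \<Rightarrow> nat \<Rightarrow> 'n weights \<Rightarrow> (nat \<times> nat \<times> nat) set" where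
  "active_units A x m k wh =
     {(r, l, j). r < m \<and> l \<in> {1..k} \<and> j < width A l \<and> 0 < hidden_vals A wh (x r) k l j}"

lemma hidden_vals_from_active_units:
  assumes "active_units A x m k wh = act" "r < m" "j < width A l"
  shows "hidden_vals A wh (x r) k l j = gated_vals A wh (x r) {(l, j). (r, l, j) \<in> act} k l j"
  by (rule gated_vals_eq_hidden_vals[symmetric]) (use assms in \<open>auto simp: active_units_def\<close>)

text \<open>Write \<open>W\<close> for \<open>num_weights A\<close>. With the pattern of layers up
  to \<open>k\<close> fixed, the at most \<open>m * W\<close> preactivations of the next layer are
  polynomials in the weights, of degree at most \<open>k + 1 \<le> W\<close>. Their sign patterns
  contribute one factor \<open>(2 * m * W\<^sup>2 + 1) ^ W\<close> per layer.\<close>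

lemma card_active_units_le:
  fixes A :: "'n::finite arch"
  assumes "wf_arch A" "k \<le> depth A"
  shows "finite (range (active_units A x m k)) \<and>
    card (range (active_units A x m k)) \<le>
      (2 * m * num_weights A ^ 2 + 1) ^ (num_weights A * k)"
  using \<open>k \<le> depth A\<close>
proof (induction k)
  case 0
  have "range (active_units A x m 0) = {{}}" by (auto simp: active_units_def)
  then show ?case by simp
next
  case (Suc k)
  let ?W = "num_weights A"
  let ?B = "(2 * m * ?W ^ 2 + 1) ^ ?W"
  let ?J = "{..<m} \<times> {..<width A (Suc k)}"
  let ?h = "\<lambda>wh r j. preact A wh (x r) (hidden_vals A wh (x r) k) (Hid (Suc k) j)"
  have IH: "finite (range (active_units A x m k))"
    "card (range (active_units A x m k)) \<le> (2 * m * ?W ^ 2 + 1) ^ (?W * k)"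
    using Suc by auto
  have fibre: "finite (active_units A x m (Suc k) ` {v. active_units A x m k v = act})
    \<and> card (active_units A x m (Suc k) ` {v. active_units A x m k v = act}) \<le> ?B" for act
  proof -
    define f where "f = (\<lambda>(r, j) \<theta>. preact A (weights_of \<theta>) (x r)
        (gated_vals A (weights_of \<theta>) (x r) {(l, j). (r, l, j) \<in> act} k) (Hid (Suc k) j))"
    define pat where "pat = (\<lambda>\<theta>. {q \<in> ?J. f q \<theta> > 0})"
    define ext where "ext S = act \<union> (\<lambda>(r, j). (r, Suc k, j)) ` S" for S
    have poly: "polyfun (params A) (Suc k) (f q)" if "q \<in> ?J" for q
      using that Suc.prems unfolding f_def
      by (auto split: prod.splits simp: is_hidden_def intro!: polyfun_preact polyfun_gated_vals)
    have sub: "active_units A x m (Suc k) ` {v. active_units A x m k v = act} \<subseteq> ext ` range pat"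
    proof clarify
      fix wh assume act: "act = active_units A x m k wh"
      obtain \<theta> where \<theta>: "wh = weights_of \<theta>" using surj_weights_of by (metis surjE)
      have "f (r, j) \<theta> = ?h wh r j" if "r < m" for r j
        using hidden_vals_from_active_units[OF act[symmetric] that]
        unfolding f_def prod.case \<theta>[symmetric] by (intro preact_cong) simp
      then have "pat \<theta> = {(r, j). r < m \<and> j < width A (Suc k) \<and> 0 < ?h wh r j}"
        by (auto simp: pat_def)
      then have "active_units A x m (Suc k) wh = ext (pat \<theta>)"
        by (auto simp: ext_def act active_units_def image_iff)
      then show "active_units A x m (Suc k) wh \<in> ext ` range pat" by blast
    qed
    have fin: "finite (range pat)"
      by (rule finite_subset[of _ "Pow ?J"]) (auto simp: pat_def)
    have "card (active_units A x m (Suc k) ` {v. active_units A x m k v = act}) \<le> card (ext ` range pat)"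
      by (rule card_mono) (use fin sub in auto)
    also have "\<dots> \<le> card (range pat)" by (rule card_image_le[OF fin])
    also have "\<dots> \<le> (2 * card ?J * Suc k + 1) ^ card (params A)"
      unfolding pat_def
      by (rule card_sign_patterns_le[OF finite_params[OF assms(1)] _ poly]) auto
    also have "\<dots> \<le> ?B"
    proof -
      have "width A (Suc k) * Suc k \<le> ?W * ?W"
        using width_less_num_weights[of "Suc k" A] depth_less_num_weights[OF assms(1)] Suc.prems
        by (intro mult_le_mono) auto
      then have "m * (width A (Suc k) * Suc k) \<le> m * (?W * ?W)" by (rule mult_le_mono2)
      then show ?thesis
        unfolding card_params[OF assms(1)]
        by (intro power_mono)
          (simp_all add: card_cartesian_product power2_eq_square mult.assoc del: mult_Suc_right)
    qed
    finally show ?thesis using finite_subset[OF sub] fin by auto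
  qed
  have "card (range (active_units A x m (Suc k))) \<le> card (range (active_units A x m k)) * ?B"
    by (rule card_range_fibres_le[OF IH(1)]) (use fibre in auto)
  also have "\<dots> \<le> (2 * m * ?W ^ 2 + 1) ^ (?W * k) * ?B" using IH(2) by (rule mult_right_mono) simp
  also have "\<dots> = (2 * m * ?W ^ 2 + 1) ^ (?W * Suc k)" by (simp add: power_add)
  finally show ?case
    using card_range_fibres_le(1)[OF IH(1), of "active_units A x m (Suc k)" ?B] fibre by auto
qed

text \<open>The first factor counts the activation patterns of all layers. On each cell, output
  minus threshold is a polynomial of degree at most \<open>depth A + 1\<close>, which gives the
  second. The number of thresholds enters only to the power \<open>num_weights A\<close>; the
  continuous case exploits this.\<close>

lemma card_threshold_patterns_le:
  fixes A :: "'n::finite arch"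
  assumes "wf_arch A" "finite T"
  shows "card (range (\<lambda>wh. {(r, t) \<in> {..<m} \<times> T. t < net_fun A wh (x r)})) \<le>
    (2 * m * num_weights A ^ 2 + 1) ^ (num_weights A * depth A) *
    (2 * m * card T * num_weights A + 1) ^ num_weights A"
proof -
  let ?W = "num_weights A"
  let ?L = "depth A"
  let ?B = "(2 * m * card T * ?W + 1) ^ ?W"
  let ?J = "{..<m} \<times> T"
  define Q where "Q wh = {(r, t) \<in> ?J. t < net_fun A wh (x r)}" for wh
  note act = card_active_units_le[OF assms(1) order_refl, of x m]
  have fibre: "finite (Q ` {v. active_units A x m ?L v = act}) \<and>
      card (Q ` {v. active_units A x m ?L v = act}) \<le> ?B" for act
  proof -
    define f where "f = (\<lambda>(r, t) \<theta>. preact A (weights_of \<theta>) (x r)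
        (gated_vals A (weights_of \<theta>) (x r) {(l, j). (r, l, j) \<in> act} ?L) Out + (- t))"
    define pat where "pat = (\<lambda>\<theta>. {q \<in> ?J. f q \<theta> > 0})"
    have poly: "polyfun (params A) (Suc ?L) (f q)" for q
      unfolding f_def
      by (auto split: prod.splits
          intro!: polyfun.add[OF _ polyfun.const] polyfun_preact polyfun_gated_vals
          simp del: add_uminus_conv_diff)
    have sub: "Q ` {v. active_units A x m ?L v = act} \<subseteq> range pat"
    proof clarify
      fix wh assume act: "act = active_units A x m ?L wh"
      obtain \<theta> where \<theta>: "wh = weights_of \<theta>" using surj_weights_of by (metis surjE)
      have "f (r, t) \<theta> = net_fun A wh (x r) - t" if "r < m" for r t
        using hidden_vals_from_active_units[OF act[symmetric] that]
        unfolding f_def prod.case \<theta>[symmetric] net_fun_def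
        by (simp add: preact_cong[of A "gated_vals A wh (x r) {(l, j). (r, l, j) \<in> act} ?L"
              "hidden_vals A wh (x r) ?L"])
      then have "Q wh = pat \<theta>"
        by (auto simp: pat_def Q_def)
      then show "Q wh \<in> range pat" by blast
    qed
    have fin: "finite (range pat)"
      by (rule finite_subset[of _ "Pow ?J"]) (use assms in \<open>auto simp: pat_def\<close>)
    have "card (Q ` {v. active_units A x m ?L v = act}) \<le> card (range pat)"
      by (rule card_mono[OF fin sub])
    also have "\<dots> \<le> (2 * card ?J * Suc ?L + 1) ^ card (params A)"
      unfolding pat_def
      by (rule card_sign_patterns_le[OF finite_params[OF assms(1)] _ poly]) (use assms in auto)
    also have "\<dots> \<le> ?B"
    proof -
      have "m * card T * Suc ?L \<le> m * card T * ?W"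
        using depth_less_num_weights[OF assms(1)] by (intro mult_le_mono) auto
      then show ?thesis
        unfolding card_params[OF assms(1)]
        by (intro power_mono) (simp_all add: card_cartesian_product mult.assoc del: mult_Suc_right)
    qed
    finally show ?thesis using finite_subset[OF sub fin] by auto
  qed
  have "card (range Q) \<le> card (range (active_units A x m ?L)) * ?B"
    by (rule card_range_fibres_le) (use act fibre in auto)
  also have "\<dots> \<le> (2 * m * ?W ^ 2 + 1) ^ (?W * ?L) * ?B"
    using act by (intro mult_right_mono) auto
  finally show ?thesis by (simp add: Q_def[abs_def])
qed

section \<open>Bump functions on a grid\<close>

lemma unit_cube_eq_cbox: "unit_cube = cbox 0 (1 :: real ^ 'n)"
  by (auto simp: unit_cube_def mem_box_cart)

lemma compact_unit_cube: "compact (unit_cube :: (real ^ 'n) set)"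
  by (simp add: unit_cube_eq_cbox)

lemma zero_in_unit_cube: "(0 :: real ^ 'n) \<in> unit_cube"
  by (simp add: unit_cube_def)

text \<open>Input and weights both depend on a parameter \<open>s\<close>, which covers continuity
  in the input as well as continuity through the weight assignment. Continuity is asked only of
  weights of actual connections and units, matching \<open>continuous_assign\<close>.\<close>

lemma continuous_on_net_fun:
  assumes X: "\<And>i. continuous_on S (\<lambda>s. X s $ i)"
    and w: "\<And>e. e \<in> edges A \<Longrightarrow> continuous_on S (\<lambda>s. fst (w s) e)"
    and b: "\<And>u. is_hidden A u \<or> u = Out \<Longrightarrow> continuous_on S (\<lambda>s. snd (w s) u)"
  shows "continuous_on S (\<lambda>s. net_fun A (w s) (X s))"
proof -
  have pre: "continuous_on S (\<lambda>s. preact A (w s) (X s) (V s) t)"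
    if "is_hidden A t \<or> t = Out"
      "\<And>l j. l \<in> {1..depth A} \<Longrightarrow> j < width A l \<Longrightarrow> continuous_on S (\<lambda>s. V s l j)" for V t
  proof -
    have "continuous_on S (\<lambda>s. if (In i, t) \<in> edges A then fst (w s) (In i, t) * X s $ i else 0)" for i
      by (cases "(In i, t) \<in> edges A") (auto intro!: continuous_intros X w)
    moreover have "continuous_on S (\<lambda>s. if (Hid l j, t) \<in> edges A then fst (w s) (Hid l j, t) * V s l j else 0)"
      if "l \<in> {1..depth A}" "j < width A l" for l j
      using \<open>\<And>l j. l \<in> {1..depth A} \<Longrightarrow> j < width A l \<Longrightarrow> continuous_on S (\<lambda>s. V s l j)\<close>[OF that]
      by (cases "(Hid l j, t) \<in> edges A") (auto intro!: continuous_intros w)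
    ultimately show ?thesis
      unfolding preact_def using b[OF that(1)] by (intro continuous_on_add continuous_on_sum) auto
  qed
  have hid: "continuous_on S (\<lambda>s. hidden_vals A (w s) (X s) k l j)"
    if "l \<in> {1..depth A}" "j < width A l" for k l j
    using that
  proof (induction k arbitrary: l j)
    case (Suc k)
    show ?case
    proof (cases "l = Suc k")
      case True
      have "continuous_on S (\<lambda>s. preact A (w s) (X s) (hidden_vals A (w s) (X s) k) (Hid l j))"
        by (rule pre) (use Suc in \<open>auto simp: is_hidden_def\<close>)
      with True show ?thesis by (auto intro!: continuous_intros)
    qed (use Suc in simp)
  qed simp
  show ?thesis
    unfolding net_fun_def by (rule pre) (use hid in auto)
qed

lemma continuous_on_net_fun_input: "continuous_on S (net_fun A wh)"
  using continuous_on_net_fun[of S "\<lambda>x. x" A "\<lambda>_. wh"] by (simp add: continuous_intros)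

text \<open>Compactness of the cube bounds the set under \<open>Sup\<close>, so its elements lie
  below the supremum.\<close>

lemma abs_diff_le_sup_dist:
  assumes "continuous_on unit_cube f" "continuous_on unit_cube g" "x \<in> unit_cube"
  shows "\<bar>f x - g x\<bar> \<le> sup_dist f g"
proof -
  have "compact ((\<lambda>x. \<bar>f x - g x\<bar>) ` unit_cube)"
    using assms by (intro compact_continuous_image continuous_intros compact_unit_cube)
  then have "bdd_above ((\<lambda>x. \<bar>f x - g x\<bar>) ` unit_cube)"
    by (intro bounded_imp_bdd_above compact_imp_bounded)
  moreover have "{\<bar>f x - g x\<bar> | x. x \<in> unit_cube} = (\<lambda>x. \<bar>f x - g x\<bar>) ` unit_cube" by auto
  ultimately show ?thesis
    unfolding sup_dist_def using assms(3) by (auto intro!: cSup_upper)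
qed

lemma sup_dist_le:
  assumes "\<And>x. x \<in> unit_cube \<Longrightarrow> \<bar>f x - g x\<bar> \<le> B"
  shows "sup_dist f g \<le> B"
  unfolding sup_dist_def using assms zero_in_unit_cube by (intro cSup_least) blast+

lemma modcont_bounds:
  assumes "0 \<le> r" "\<And>x y. x \<in> unit_cube \<Longrightarrow> y \<in> unit_cube \<Longrightarrow> dist x y \<le> r \<Longrightarrow> \<bar>f x - f y\<bar> \<le> B"
  shows "0 \<le> modcont f r" "modcont f r \<le> B"
proof -
  let ?D = "{\<bar>f x - f y\<bar> | x y. x \<in> unit_cube \<and> y \<in> unit_cube \<and> dist x y \<le> r}"
  have "\<bar>f 0 - f 0\<bar> \<in> ?D" using zero_in_unit_cube assms(1) by force
  moreover have "bdd_above ?D" using assms(2) by (auto intro!: bdd_aboveI)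
  ultimately show "0 \<le> modcont f r" "modcont f r \<le> B"
    unfolding modcont_def using assms(2) by (force intro: cSup_upper2, intro cSup_least) auto
qed

text \<open>Cones of radius \<open>h\<close> and height \<open>h * z r\<close> centred at
  \<open>u r\<close>. With centres at least \<open>2 * h\<close> apart, at most one cone is nonzero
  at any point.\<close>

definition bump_sum :: "(nat \<Rightarrow> 'a::metric_space) \<Rightarrow> nat \<Rightarrow> real \<Rightarrow> (nat \<Rightarrow> real) \<Rightarrow> 'a \<Rightarrow> real" where
  "bump_sum u m h z x = (\<Sum>r<m. z r * max 0 (h - dist x (u r)))"

lemma continuous_on_bump_sum: "continuous_on S (bump_sum u m h z)"
  unfolding bump_sum_def[abs_def] by (intro continuous_intros)

lemma bump_sum_at:
  assumes "0 < h" "\<And>r s. r < m \<Longrightarrow> s < m \<Longrightarrow> r \<noteq> s \<Longrightarrow> 2 * h \<le> dist (u r) (u s)" "r < m"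
  shows "bump_sum u m h z (u r) = h * z r"
proof -
  have "z s * max 0 (h - dist (u r) (u s)) = (if s = r then h * z r else 0)" if "s < m" for s
    using assms(1) assms(2)[OF assms(3) that] by auto
  then show ?thesis using assms(3) by (simp add: bump_sum_def)
qed

text \<open>At each of \<open>x\<close> and \<open>y\<close> at most one cone is nonzero, so at most
  two summands change, each by at most \<open>dist x y\<close>.\<close>

lemma bump_sum_lipschitz:
  assumes "0 < h" and sep: "\<And>r s. r < m \<Longrightarrow> s < m \<Longrightarrow> r \<noteq> s \<Longrightarrow> 2 * h \<le> dist (u r) (u s)"
    and z: "\<And>r. r < m \<Longrightarrow> \<bar>z r\<bar> \<le> 1"
  shows "\<bar>bump_sum u m h z x - bump_sum u m h z y\<bar> \<le> 2 * dist x y"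
proof -
  define \<phi> where "\<phi> r x = max 0 (h - dist x (u r))" for r x
  define N where "N x = {r. r < m \<and> \<phi> r x \<noteq> 0}" for x
  have fin: "finite (N x)" for x by (simp add: N_def)
  have "card (N x) \<le> Suc 0" for x
    unfolding card_le_Suc0_iff_eq[OF fin]
  proof (intro ballI, rule ccontr)
    fix r s assume rs: "r \<in> N x" "s \<in> N x" "r \<noteq> s"
    then have "dist x (u r) < h" "dist x (u s) < h" "2 * h \<le> dist (u r) (u s)"
      using sep[of r s] by (auto simp: N_def \<phi>_def split: if_splits)
    then show False using dist_triangle2[of "u r" "u s" x] by (simp add: dist_commute)
  qed
  then have "card (N x \<union> N y) \<le> 2"
    using card_Un_le[of "N x" "N y"] by (metis Suc_1 add_le_mono le_trans one_add_one One_nat_def)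
  have "bump_sum u m h z x - bump_sum u m h z y = (\<Sum>r<m. z r * (\<phi> r x - \<phi> r y))"
    by (simp add: bump_sum_def \<phi>_def sum_subtractf right_diff_distrib)
  also have "\<dots> = (\<Sum>r\<in>N x \<union> N y. z r * (\<phi> r x - \<phi> r y))"
    by (rule sum.mono_neutral_right) (auto simp: N_def)
  also have "\<bar>\<dots>\<bar> \<le> (\<Sum>r\<in>N x \<union> N y. dist x y)"
  proof (rule order_trans[OF sum_abs], rule sum_mono)
    fix r assume "r \<in> N x \<union> N y"
    then have "\<bar>z r\<bar> \<le> 1" using z by (auto simp: N_def)
    moreover have "\<bar>\<phi> r x - \<phi> r y\<bar> \<le> dist x y"
      using dist_triangle[of x "u r" y] dist_triangle[of y "u r" x]
      by (auto simp: \<phi>_def dist_commute)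
    ultimately have "\<bar>z r\<bar> * \<bar>\<phi> r x - \<phi> r y\<bar> \<le> 1 * dist x y" by (intro mult_mono) auto
    then show "\<bar>z r * (\<phi> r x - \<phi> r y)\<bar> \<le> dist x y" by (simp add: abs_mult)
  qed
  also have "\<dots> \<le> 2 * dist x y"
    using \<open>card (N x \<union> N y) \<le> 2\<close> by (simp add: mult_right_mono)
  finally show ?thesis .
qed

text \<open>Gives continuity of the bump sum in \<open>z\<close> for the sup norm, since the bound
  is uniform in \<open>x\<close>.\<close>

lemma bump_sum_diff_le:
  assumes "0 \<le> h"
  shows "\<bar>bump_sum u m h z x - bump_sum u m h z' x\<bar> \<le> h * (\<Sum>r<m. \<bar>z r - z' r\<bar>)"
proof -
  have "bump_sum u m h z x - bump_sum u m h z' x = (\<Sum>r<m. (z r - z' r) * max 0 (h - dist x (u r)))"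
    by (simp add: bump_sum_def sum_subtractf left_diff_distrib)
  also have "\<bar>\<dots>\<bar> \<le> (\<Sum>r<m. h * \<bar>z r - z' r\<bar>)"
  proof (rule order_trans[OF sum_abs], rule sum_mono)
    fix r
    have "\<bar>z r - z' r\<bar> * max 0 (h - dist x (u r)) \<le> \<bar>z r - z' r\<bar> * h"
      using assms by (intro mult_left_mono) auto
    then show "\<bar>(z r - z' r) * max 0 (h - dist x (u r))\<bar> \<le> h * \<bar>z r - z' r\<bar>"
      by (simp add: abs_mult mult.commute)
  qed
  finally show ?thesis by (simp add: sum_distrib_left)
qed

text \<open>The points have coordinates \<open>j / n\<close> with \<open>j < n\<close>; distinct
  ones differ by at least \<open>1 / n\<close> in some coordinate.\<close>

lemma exists_grid:
  assumes "0 < n"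
  obtains u :: "nat \<Rightarrow> real ^ 'n::finite" where
    "\<And>r. r < n ^ CARD('n) \<Longrightarrow> u r \<in> unit_cube"
    "\<And>r s. r < n ^ CARD('n) \<Longrightarrow> s < n ^ CARD('n) \<Longrightarrow> r \<noteq> s \<Longrightarrow> 1 / real n \<le> dist (u r) (u s)"
proof -
  let ?G = "PiE (UNIV :: 'n set) (\<lambda>_. {..<n})"
  have "finite ?G" by (intro finite_PiE) auto
  moreover have "card ?G = n ^ CARD('n)" by (simp add: card_PiE)
  ultimately obtain e where e: "bij_betw e {0..<n ^ CARD('n)} ?G"
    using ex_bij_betw_nat_finite by metis
  define u :: "nat \<Rightarrow> real ^ 'n" where "u r = (\<chi> i. real (e r i) / real n)" for r
  show thesis
  proof
    fix r assume "r < n ^ CARD('n)"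
    then have "e r \<in> ?G" using bij_betwE[OF e] by simp
    then have "e r i \<le> n" for i by (auto dest: PiE_mem intro: less_imp_le)
    then show "u r \<in> unit_cube" using assms by (simp add: u_def unit_cube_def)
  next
    fix r s assume "r < n ^ CARD('n)" "s < n ^ CARD('n)" "r \<noteq> s"
    then have "e r \<noteq> e s" using e by (auto simp: bij_betw_def inj_on_def)
    then obtain i where "e r i \<noteq> e s i" by auto
    then have "1 \<le> \<bar>real (e r i) - real (e s i)\<bar>" by linarith
    then have "1 / real n \<le> dist (u r $ i) (u s $ i)"
      using assms by (simp add: u_def dist_real_def divide_right_mono flip: diff_divide_distrib)
    then show "1 / real n \<le> dist (u r) (u s)"
      using dist_vec_nth_le[of "u r" i "u s"] by linarith
  qed
qed

section \<open>Grid values forced by the approximation rate\<close>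

text \<open>For such \<open>f\<close> the modulus of continuity at \<open>r\<close> is at most
  \<open>2 * r\<close>. The absolute value in \<open>max 1 (\<bar>a\<bar> * 2 * c)\<close> is there
  because \<open>a\<close> has no prescribed sign; \<open>1 \<le> K\<close> makes later divisions
  safe.\<close>

lemma rate_achieved_lipschitz:
  fixes archs :: "nat \<Rightarrow> 'n::finite arch"
  assumes "rate_achieved p archs assign"
  obtains K where "1 \<le> K" "\<And>W f x. 0 < W \<Longrightarrow> continuous_on unit_cube f \<Longrightarrow>
    (\<And>x y. \<bar>f x - f y\<bar> \<le> 2 * dist x y) \<Longrightarrow> x \<in> unit_cube \<Longrightarrow>
    \<bar>f x - net_fun (archs W) (assign W f) x\<bar> \<le> K * real W powr (- p)"
proof -
  obtain a c where c: "0 < c" and rate: "\<And>f W. continuous_on unit_cube f \<Longrightarrow> 0 < W \<Longrightarrow>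
      sup_dist f (net_fun (archs W) (assign W f)) \<le> a * modcont f (c * real W powr (- p))"
    using assms unfolding rate_achieved_def by blast
  show thesis
  proof
    show "1 \<le> max 1 (\<bar>a\<bar> * 2 * c)" by simp
    fix W :: nat and f :: "real ^ 'n \<Rightarrow> real" and x :: "real ^ 'n"
    assume W: "0 < W" and f: "continuous_on unit_cube f"
      and lip: "\<And>x y. \<bar>f x - f y\<bar> \<le> 2 * dist x y" and x: "x \<in> unit_cube"
    let ?r = "c * real W powr (- p)"
    have "0 \<le> ?r" using c by simp
    have mc: "0 \<le> modcont f ?r" "modcont f ?r \<le> 2 * ?r"
      by (rule modcont_bounds[OF \<open>0 \<le> ?r\<close>, of f "2 * ?r"]; rule order_trans[OF lip]; simp)+
    have "\<bar>f x - net_fun (archs W) (assign W f) x\<bar> \<le> sup_dist f (net_fun (archs W) (assign W f))"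
      by (intro abs_diff_le_sup_dist f continuous_on_net_fun_input x)
    also have "\<dots> \<le> a * modcont f ?r" by (rule rate[OF f W])
    also have "\<dots> \<le> \<bar>a\<bar> * modcont f ?r" using mc by (intro mult_right_mono) auto
    also have "\<dots> \<le> \<bar>a\<bar> * (2 * ?r)" using mc by (intro mult_left_mono) auto
    also have "\<dots> = (\<bar>a\<bar> * 2 * c) * real W powr (- p)" by simp
    also have "\<dots> \<le> max 1 (\<bar>a\<bar> * 2 * c) * real W powr (- p)" by (intro mult_right_mono) auto
    finally show "\<bar>f x - net_fun (archs W) (assign W f) x\<bar> \<le> max 1 (\<bar>a\<bar> * 2 * c) * real W powr (- p)" .
  qed
qed

text \<open>The grid is as fine as the error permits, up to a constant: \<open>n\<close> is of order
  \<open>W powr p\<close>, and the error is a quarter of the bump height. The lower bound on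
  \<open>m\<close> yields the final estimates; the upper bound controls the logarithm of the pattern
  count.\<close>

lemma rate_achieved_bump_sums:
  fixes archs :: "nat \<Rightarrow> 'n::finite arch"
  assumes "rate_achieved p archs assign" "0 < p"
  obtains c where "0 < c"
    "\<forall>\<^sub>F W in sequentially. \<exists>m h u.
       c * real W powr (p * CARD('n)) \<le> real m \<and> real m \<le> real W powr (p * CARD('n)) \<and>
       0 < h \<and>
       (\<forall>z. (\<forall>r<m. \<bar>z r\<bar> \<le> 1) \<longrightarrow>
          (\<forall>r<m. \<bar>h * z r - net_fun (archs W) (assign W (bump_sum u m h z)) (u r)\<bar> \<le> h / 4))"
proof -
  obtain K where K: "1 \<le> K" and err: "\<And>W f x. 0 < W \<Longrightarrow> continuous_on unit_cube f \<Longrightarrow>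
    (\<And>x y. \<bar>f x - f y\<bar> \<le> 2 * dist x y) \<Longrightarrow> x \<in> unit_cube \<Longrightarrow>
    \<bar>f x - net_fun (archs W) (assign W f) x\<bar> \<le> K * real W powr (- p)"
    using rate_achieved_lipschitz[OF assms(1)] by blast
  let ?\<nu> = "CARD('n)"
  have powers: "(real W powr p) ^ ?\<nu> = real W powr (p * ?\<nu>)" if "0 < W" for W
    using that by (simp add: powr_powr flip: powr_realpow)
  have large: "\<forall>\<^sub>F W in sequentially. 16 * K \<le> real W powr p"
    using assms(2) by real_asymp
  show thesis
  proof
    show "0 < (1 / (16 * K)) ^ ?\<nu>" using K by simp
    show "\<forall>\<^sub>F W in sequentially. \<exists>m h u.
       (1 / (16 * K)) ^ ?\<nu> * real W powr (p * CARD('n)) \<le> real m \<and> real m \<le> real W powr (p * CARD('n)) \<and>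
       0 < h \<and>
       (\<forall>z. (\<forall>r<m. \<bar>z r\<bar> \<le> 1) \<longrightarrow>
          (\<forall>r<m. \<bar>h * z r - net_fun (archs W) (assign W (bump_sum u m h z)) (u r)\<bar> \<le> h / 4))"
      using large eventually_gt_at_top[of 0]
    proof eventually_elim
      case (elim W)
      \<comment> \<open>The bound \<open>n \<le> X\<close> says exactly that the error
        \<open>K * W powr (- p)\<close> is at most \<open>1 / (8 * n) = h / 4\<close>. As
        \<open>2 \<le> X\<close>, rounding down costs at most a factor two, whence the 16 in the
        constant.\<close>
      define X where "X = real W powr p / (8 * K)"
      define n where "n = nat \<lfloor>X\<rfloor>"
      have "2 \<le> X" using elim K by (simp add: X_def field_simps)
      then have n: "real n \<le> X" "X / 2 \<le> real n" "0 < n" unfolding n_def by linarith+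
      define h where "h = 1 / (2 * real n)"
      obtain u :: "nat \<Rightarrow> real ^ 'n" where u: "\<And>r. r < n ^ ?\<nu> \<Longrightarrow> u r \<in> unit_cube"
        "\<And>r s. r < n ^ ?\<nu> \<Longrightarrow> s < n ^ ?\<nu> \<Longrightarrow> r \<noteq> s \<Longrightarrow> 1 / real n \<le> dist (u r) (u s)"
        using exists_grid[OF n(3)] by blast
      have h: "0 < h" "2 * h = 1 / real n" using n by (simp_all add: h_def)
      have "real n * (8 * K) \<le> real W powr p" using n(1) K by (simp add: X_def pos_le_divide_eq)
      then have Kh: "K * real W powr (- p) \<le> h / 4"
        using n(3) elim by (simp add: powr_minus h_def field_simps)
      have "(1 / (16 * K)) ^ ?\<nu> * real W powr (p * ?\<nu>) = (X / 2) ^ ?\<nu>"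
        using elim powers[of W] by (simp add: X_def power_divide power_mult_distrib)
      also have "\<dots> \<le> real n ^ ?\<nu>" using n(2) \<open>2 \<le> X\<close> by (intro power_mono) auto
      finally have 1: "(1 / (16 * K)) ^ ?\<nu> * real W powr (p * ?\<nu>) \<le> real (n ^ ?\<nu>)" by simp
      have "X \<le> real W powr p" 
        using K divide_left_mono[of 1 "8 * K" "real W powr p"] by (simp add: X_def)
      then have "real n ^ ?\<nu> \<le> (real W powr p) ^ ?\<nu>" using n(1) by (intro power_mono) auto
      then have 2: "real (n ^ ?\<nu>) \<le> real W powr (p * ?\<nu>)" using powers[of W] elim by simp
      have 3: "\<bar>h * z r - net_fun (archs W) (assign W (bump_sum u (n ^ ?\<nu>) h z)) (u r)\<bar> \<le> h / 4"
        if z: "\<forall>r<n ^ ?\<nu>. \<bar>z r\<bar> \<le> 1" and r: "r < n ^ ?\<nu>" for z r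
      proof -
        have "\<bar>bump_sum u (n ^ ?\<nu>) h z (u r) - net_fun (archs W) (assign W (bump_sum u (n ^ ?\<nu>) h z)) (u r)\<bar>
          \<le> K * real W powr (- p)"
          using z h u r elim by (intro err continuous_on_bump_sum bump_sum_lipschitz) auto
        also have "bump_sum u (n ^ ?\<nu>) h z (u r) = h * z r"
          using h u(2) r by (intro bump_sum_at) auto
        finally show ?thesis using Kh by linarith
      qed
      show ?case
        by (intro exI[of _ "n ^ ?\<nu>"] exI[of _ h] exI[of _ u] conjI allI impI 1 2 3 h(1)) auto
    qed
  qed
qed

section \<open>Depth\<close>

text \<open>All \<open>2 ^ m\<close> sign vectors occur on the grid, so with depth \<open>L\<close>
  the count gives \<open>m * ln 2 \<le> W * (L + 1) * ln (2 * m * W\<^sup>2 + 1)\<close>. By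
  \<open>m \<le> W powr (p * \<nu>)\<close> the logarithm is at most
  \<open>(p * \<nu> + 4) * ln W\<close>. The \<open>+ 1\<close> stems from the output unit.\<close>

lemma depth_lower_bound:
  fixes archs :: "nat \<Rightarrow> 'n::finite arch"
  assumes "rate_achieved p archs assign" "0 < p"
  obtains d where "0 < d"
    "\<forall>\<^sub>F W in sequentially. d * real W powr (p * CARD('n) - 1) / ln (real W) \<le> real (depth (archs W)) + 1"
proof -
  let ?\<nu> = "CARD('n)"
  obtain c where c: "0 < c" and ev: "\<forall>\<^sub>F W in sequentially. \<exists>m h u.
       c * real W powr (p * ?\<nu>) \<le> real m \<and> real m \<le> real W powr (p * ?\<nu>) \<and>
       0 < h \<and>
       (\<forall>z. (\<forall>r<m. \<bar>z r\<bar> \<le> 1) \<longrightarrow>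
          (\<forall>r<m. \<bar>h * z r - net_fun (archs W) (assign W (bump_sum u m h z)) (u r)\<bar> \<le> h / 4))"
    using rate_achieved_bump_sums[OF assms] by blast
  have arch: "wf_arch (archs W)" "num_weights (archs W) = W" if "0 < W" for W
    using assms(1) that by (auto simp: rate_achieved_def)
  define d where "d = c * ln 2 / (p * ?\<nu> + 4)"
  have "0 < p * ?\<nu> + 4" using assms(2) by (intro add_nonneg_pos) auto
  then have "0 < d" using c by (simp add: d_def)
  show thesis
  proof
    show "0 < d" by fact
    show "\<forall>\<^sub>F W in sequentially. d * real W powr (p * ?\<nu> - 1) / ln (real W) \<le> real (depth (archs W)) + 1"
      using ev eventually_ge_at_top[of 2]
    proof eventually_elim
      case (elim W)
      then obtain m h u where m: "c * real W powr (p * ?\<nu>) \<le> real m" "real m \<le> real W powr (p * ?\<nu>)"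
        and h: "0 < h" and approx: "\<And>z r. (\<forall>r<m. \<bar>z r\<bar> \<le> 1) \<Longrightarrow> r < m \<Longrightarrow>
          \<bar>h * z r - net_fun (archs W) (assign W (bump_sum u m h z)) (u r)\<bar> \<le> h / 4"
        by blast
      let ?L = "depth (archs W)"
      let ?Q = "\<lambda>wh. {(r, t) \<in> {..<m} \<times> {0}. t < net_fun (archs W) wh (u r)}"
      have W: "0 < W" "2 \<le> real W" using elim by auto
      have "(\<lambda>S. S \<times> {0::real}) ` Pow {..<m} \<subseteq> range ?Q"
      proof clarify
        fix S assume S: "S \<subseteq> {..<m}"
        define z where "z r = (if r \<in> S then 1 else -1 :: real)" for r :: nat
        let ?wh = "assign W (bump_sum u m h z)"
        have "0 < net_fun (archs W) ?wh (u r) \<longleftrightarrow> r \<in> S" if "r < m" for r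
        proof -
          have "\<forall>r<m. \<bar>z r\<bar> \<le> 1" by (simp add: z_def)
          from approx[OF this that] have "\<bar>h * z r - net_fun (archs W) ?wh (u r)\<bar> \<le> h / 4" .
          then have near: "h * z r - h / 4 \<le> net_fun (archs W) ?wh (u r)"
            "net_fun (archs W) ?wh (u r) \<le> h * z r + h / 4"
            by linarith+
          show ?thesis
          proof (cases "r \<in> S")
            case True
            then have "h * z r = h" by (simp add: z_def)
            with near(1) h True show ?thesis by simp
          next
            case False
            then have "h * z r = - h" by (simp add: z_def)
            with near(2) h False show ?thesis by simp
          qed
        qed
        then have "?Q ?wh = S \<times> {0}" using S by auto
        then show "S \<times> {0} \<in> range ?Q" by (rule range_eqI[OF sym])
      qed
      moreover have "finite (range ?Q)"
        by (rule finite_subset[of _ "Pow ({..<m} \<times> {0})"]) auto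
      ultimately have "card ((\<lambda>S. S \<times> {0::real}) ` Pow {..<m}) \<le> card (range ?Q)"
        by (intro card_mono)
      also have "card ((\<lambda>S. S \<times> {0::real}) ` Pow {..<m}) = 2 ^ m"
        by (subst card_image) (auto simp: inj_on_def card_Pow times_eq_iff)
      also have "card (range ?Q) \<le> (2 * m * W ^ 2 + 1) ^ (W * ?L) * (2 * m * card {0::real} * W + 1) ^ W"
        using card_threshold_patterns_le[OF arch(1)[OF W(1)], of "{0}" m u] arch(2)[OF W(1)] by simp
      also have "\<dots> \<le> (2 * m * W ^ 2 + 1) ^ (W * ?L) * (2 * m * W ^ 2 + 1) ^ W"
        using W by (intro mult_left_mono power_mono) (auto simp: power2_eq_square)
      also have "\<dots> = (2 * m * W ^ 2 + 1) ^ (W * (?L + 1))" by (simp add: add.commute flip: power_add)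
      finally have "real (2 ^ m) \<le> real ((2 * m * W ^ 2 + 1) ^ (W * (?L + 1)))" by (subst of_nat_le_iff)
      then have "2 ^ m \<le> (2 * real m * real W ^ 2 + 1) ^ (W * (?L + 1))"
        by (simp only: of_nat_power of_nat_mult of_nat_add of_nat_numeral of_nat_1)
      moreover have pos: "0 < 2 * real m * real W ^ 2 + 1" by (intro add_nonneg_pos) auto
      ultimately have "ln (2 ^ m) \<le> ln ((2 * real m * real W ^ 2 + 1) ^ (W * (?L + 1)))"
        by (subst ln_le_cancel_iff) auto
      then have "real m * ln 2 \<le> real (W * (?L + 1)) * ln (2 * real m * real W ^ 2 + 1)"
        using pos by (simp only: ln_realpow zero_less_numeral)
      also have "real (W * (?L + 1)) = real W * (real ?L + 1)" by (simp add: distrib_left)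
      \<comment> \<open>As \<open>W \<ge> 2\<close>, the factor 3 collecting the constants is at
        most \<open>W ^ 2\<close>; together with the square already present this gives the 4 in the
        exponent.\<close>
      also have "ln (2 * real m * real W ^ 2 + 1) \<le> ln (real W powr (p * ?\<nu> + 4))"
      proof (subst ln_le_cancel_iff)
        have "1 \<le> real W powr (p * ?\<nu>)" using W assms(2) by (intro ge_one_powr_ge_zero) auto
        then have "1 \<le> real W powr (p * ?\<nu>) * real W ^ 2" using W by (simp add: mult_ge1_I)
        then have "2 * real m * real W ^ 2 + 1 \<le> 3 * (real W powr (p * ?\<nu>) * real W ^ 2)"
          using mult_right_mono[OF m(2), of "real W ^ 2"] by simp
        also have "\<dots> \<le> real W ^ 2 * (real W powr (p * ?\<nu>) * real W ^ 2)"
          using W power_mono[of 2 "real W" 2] by (intro mult_right_mono) auto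
        also have "\<dots> = real W powr (p * ?\<nu>) * real W ^ 4" by (simp add: power2_eq_square power4_eq_xxxx)
        also have "\<dots> = real W powr (p * ?\<nu> + 4)" using W by (simp add: powr_add)
        finally show "2 * real m * real W ^ 2 + 1 \<le> real W powr (p * ?\<nu> + 4)" .
      qed (use W pos in auto)
      also have "\<dots> = (p * ?\<nu> + 4) * ln W" using W by (simp add: ln_powr)
      finally have "real m * ln 2 \<le> real W * (real ?L + 1) * ((p * ?\<nu> + 4) * ln W)"
        by (simp add: mult_left_mono)
      moreover have "c * real W powr (p * ?\<nu>) * ln 2 \<le> real m * ln 2"
        using m(1) by (intro mult_right_mono) auto
      ultimately have "c * real W powr (p * ?\<nu>) * ln 2 \<le>
         real W * (real ?L + 1) * ((p * ?\<nu> + 4) * ln (real W))" by (rule order_trans[rotated])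
      moreover have "real W powr (p * ?\<nu>) = real W powr (p * ?\<nu> - 1) * real W"
        using W by (simp add: powr_diff)
      ultimately have "real W * (c * ln 2 * real W powr (p * ?\<nu> - 1)) \<le>
         real W * ((real ?L + 1) * ((p * ?\<nu> + 4) * ln W))"
        by (simp only: mult.assoc mult.commute mult.left_commute)
      then have "c * ln 2 * real W powr (p * ?\<nu> - 1) \<le> (real ?L + 1) * ((p * ?\<nu> + 4) * ln W)"
        using W by (subst (asm) mult_le_cancel_left_pos) auto
      moreover have "0 < ln (real W)" using W by simp
      ultimately have "c * ln 2 * real W powr (p * ?\<nu> - 1) / ((p * ?\<nu> + 4) * ln W) \<le> real ?L + 1"
        using \<open>0 < p * ?\<nu> + 4\<close> by (subst pos_divide_le_eq) (auto intro!: mult_pos_pos)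
      then show "d * real W powr (p * ?\<nu> - 1) / ln (real W) \<le> real ?L + 1"
        by (simp add: d_def)
    qed
  qed
qed

section \<open>Continuous weight assignments\<close>

text \<open>An approximate form of the Poincare--Miranda theorem in arbitrary dimension \<open>N\<close>,
  read off from Kuhn's combinatorial lemma.\<close>
lemma approximate_poincare_miranda:
  fixes f :: "(nat \<Rightarrow> real) \<Rightarrow> nat \<Rightarrow> real"
  assumes cont: "\<And>i. i < N \<Longrightarrow> continuous_on UNIV (\<lambda>z. f z i)"
    and lo: "\<And>z i. \<forall>r<N. \<bar>z r\<bar> \<le> 1 \<Longrightarrow> i < N \<Longrightarrow> z i = -1 \<Longrightarrow> f z i < 0"
    and hi: "\<And>z i. \<forall>r<N. \<bar>z r\<bar> \<le> 1 \<Longrightarrow> i < N \<Longrightarrow> z i = 1 \<Longrightarrow> 0 < f z i"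
    and "0 < \<epsilon>"
  shows "\<exists>z. (\<forall>i<N. \<bar>z i\<bar> \<le> 1) \<and> (\<forall>i<N. \<bar>f z i\<bar> < \<epsilon>)"
proof -
  \<comment> \<open>Coordinates from \<open>N\<close> on are fixed at 0, so that the cube is compact
    in the product topology.\<close>
  define K where "K = {z :: nat \<Rightarrow> real. \<forall>i. z i \<in> (if i \<in> {..<N} then {-1..1} else {0})}"
  have "compact K" unfolding K_def by (rule compact_box_fun)
  have "\<exists>\<delta>>0. \<forall>z\<in>K. \<forall>z'\<in>K. dist z' z < \<delta> \<longrightarrow> dist (f z' i) (f z i) < \<epsilon>" if "i < N" for i
    using compact_uniformly_continuous[OF continuous_on_subset[OF cont[OF that]] \<open>compact K\<close>] \<open>0 < \<epsilon>\<close>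
    unfolding uniformly_continuous_on_def by auto
  then obtain D where D: "\<And>i. i < N \<Longrightarrow> 0 < D i"
    "\<And>i z z'. i < N \<Longrightarrow> z \<in> K \<Longrightarrow> z' \<in> K \<Longrightarrow> dist z' z < D i \<Longrightarrow> dist (f z' i) (f z i) < \<epsilon>"
    by metis
  define \<delta> where "\<delta> = Min (insert 1 (D ` {..<N}))"
  have "0 < \<delta>" unfolding \<delta>_def using D(1) by (subst Min_gr_iff) auto
  have uc: "\<bar>f z' i - f z i\<bar> < \<epsilon>" if "i < N" "z \<in> K" "z' \<in> K" "dist z' z < \<delta>" for i z z'
  proof -
    have "\<delta> \<le> D i" unfolding \<delta>_def using that(1) by (intro Min_le) auto
    with D(2)[OF that(1-3)] that(4) show ?thesis by (simp add: dist_real_def)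
  qed
  \<comment> \<open>The metric on functions weights coordinates geometrically: \<open>M\<close>
    makes the tail less than \<open>\<delta> / 2\<close>, and the mesh
    \<open>2 / p < \<delta> / 4\<close> chosen next bounds the leading part.\<close>
  obtain M where M: "(1 / 2 :: real) ^ M < \<delta> / 2"
    using real_arch_pow_inv[of "\<delta> / 2" "1 / 2"] \<open>0 < \<delta>\<close> by auto
  obtain p where p: "8 / \<delta> < real p" using reals_Archimedean2 by blast
  have "0 < p" using p \<open>0 < \<delta>\<close> by (cases p) (auto simp: divide_less_0_iff)
  have "2 / real p < \<delta> / 4" using p \<open>0 < p\<close> \<open>0 < \<delta>\<close> by (simp add: field_simps)
  define pt where "pt x = (\<lambda>i. if i < N then 2 * real (x i) / real p - 1 else 0)" for x
  have ptK: "pt x \<in> K" if "\<forall>i<N. x i \<le> p" for x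
    using that \<open>0 < p\<close> by (auto simp: K_def pt_def divide_simps)
  have pt_abs: "\<forall>r<N. \<bar>pt x r\<bar> \<le> 1" if "\<forall>i<N. x i \<le> p" for x
    using ptK[OF that] by (auto simp: K_def abs_le_iff split: if_splits)
  have pt_dist: "dist (pt x) (pt y) < \<delta>" if "\<forall>i<N. y i \<le> x i \<and> x i \<le> y i + 1" for x y
  proof -
    have coord: "dist (pt x i) (pt y i) \<le> 2 / real p" for i
    proof (cases "i < N")
      case True
      then have "pt x i - pt y i = 2 * (real (x i) - real (y i)) / real p"
        by (simp add: pt_def right_diff_distrib diff_divide_distrib)
      moreover have "\<bar>real (x i) - real (y i)\<bar> \<le> 1" using that True by auto
      ultimately show ?thesis
        by (simp add: dist_real_def abs_mult divide_right_mono)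
    qed (simp add: pt_def)
    let ?S = "{dist (pt x (from_nat n)) (pt y (from_nat n)) | n. n \<le> M}"
    have "?S = (\<lambda>n. dist (pt x (from_nat n)) (pt y (from_nat n))) ` {..M}" by auto
    then have "finite ?S" "?S \<noteq> {}" by auto
    then have "Max ?S \<le> 2 / real p" using coord by (subst Max_le_iff) auto
    then have "dist (pt x) (pt y) \<le> 2 * (2 / real p) + (1 / 2) ^ M"
      using dist_fun_le_dist_first_terms[of "pt x" "pt y" M] by linarith
    with M \<open>2 / real p < \<delta> / 4\<close> show ?thesis by linarith
  qed
  \<comment> \<open>Labels record whether a component is negative. A cell carrying both labels for
    \<open>i\<close> shows a sign change, and uniform continuity makes component \<open>i\<close>
    small at its corner \<open>q\<close>.\<close>
  define label where "label x i = (if f (pt x) i < 0 then 0 else 1 :: nat)" for x i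
  have lab: "\<forall>x. (\<forall>i<N. x i \<le> p) \<longrightarrow> (\<forall>i<N. label x i = 0 \<or> label x i = 1)"
    by (simp add: label_def)
  have lab0: "\<forall>x. (\<forall>i<N. x i \<le> p) \<longrightarrow> (\<forall>i<N. x i = 0 \<longrightarrow> label x i = 0)"
  proof (intro allI impI)
    fix x i assume x: "\<forall>i<N. x i \<le> p" "i < N" "x i = 0"
    have "f (pt x) i < 0" by (rule lo[OF pt_abs[OF x(1)] x(2)]) (use x in \<open>simp add: pt_def\<close>)
    then show "label x i = 0" by (simp add: label_def)
  qed
  have lab1: "\<forall>x. (\<forall>i<N. x i \<le> p) \<longrightarrow> (\<forall>i<N. x i = p \<longrightarrow> label x i = 1)"
  proof (intro allI impI)
    fix x i assume x: "\<forall>i<N. x i \<le> p" "i < N" "x i = p"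
    have "0 < f (pt x) i"
      by (rule hi[OF pt_abs[OF x(1)] x(2)]) (use x \<open>0 < p\<close> in \<open>simp add: pt_def\<close>)
    then show "label x i = 1" by (simp add: label_def)
  qed
  obtain q where q: "\<forall>i<N. q i < p"
    "\<forall>i<N. \<exists>r s. (\<forall>j<N. q j \<le> r j \<and> r j \<le> q j + 1) \<and>
      (\<forall>j<N. q j \<le> s j \<and> s j \<le> q j + 1) \<and> label r i \<noteq> label s i"
    by (rule kuhn_lemma[OF \<open>0 < p\<close> lab lab0 lab1])
  have small: "\<bar>f (pt q) i\<bar> < \<epsilon>" if "i < N" for i
  proof -
    obtain r s where rs: "\<forall>j<N. q j \<le> r j \<and> r j \<le> q j + 1" "\<forall>j<N. q j \<le> s j \<and> s j \<le> q j + 1"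
      "label r i \<noteq> label s i" using q(2)[THEN spec, THEN mp, OF \<open>i < N\<close>] by (elim exE conjE)
    have le: "\<forall>j<N. q j \<le> p" "\<forall>j<N. r j \<le> p" "\<forall>j<N. s j \<le> p"
    proof -
      show "\<forall>j<N. q j \<le> p" using q(1) by (simp add: less_imp_le)
      have "x \<le> p" if "x \<le> q j + 1" "j < N" for x j using q(1) that by fastforce
      then show "\<forall>j<N. r j \<le> p" "\<forall>j<N. s j \<le> p" using rs(1,2) by blast+
    qed
    have "\<bar>f (pt r) i - f (pt q) i\<bar> < \<epsilon>" "\<bar>f (pt s) i - f (pt q) i\<bar> < \<epsilon>"
      by (intro uc ptK pt_dist that le rs(1,2))+
    moreover have "f (pt r) i < 0 \<and> 0 \<le> f (pt s) i \<or> f (pt s) i < 0 \<and> 0 \<le> f (pt r) i"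
      using rs(3) by (auto simp: label_def split: if_splits)
    ultimately show ?thesis by (auto simp: abs_less_iff)
  qed
  show ?thesis
    using pt_abs[of q] small q(1) by (intro exI[of _ "pt q"]) (auto intro: less_imp_le)
qed

text \<open>The sum over the first \<open>m\<close> coordinates is continuous for the product
  topology, so this criterion turns the estimate of \<open>bump_sum_diff_le\<close> into topological
  continuity.\<close>

lemma continuous_on_UNIV_fun_coordinates:
  fixes g :: "(nat \<Rightarrow> real) \<Rightarrow> real"
  assumes "\<And>z \<epsilon>. 0 < \<epsilon> \<Longrightarrow> \<exists>\<delta>>0. \<forall>z'. (\<Sum>r<m. \<bar>z r - z' r\<bar>) < \<delta> \<longrightarrow> \<bar>g z - g z'\<bar> < \<epsilon>"
  shows "continuous_on UNIV g"
  unfolding continuous_on_eq_continuous_at[OF open_UNIV]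
proof
  fix z
  show "isCont g z"
    unfolding isCont_def tendsto_iff
  proof (intro allI impI)
    fix \<epsilon> :: real assume "0 < \<epsilon>"
    then obtain \<delta> where \<delta>: "0 < \<delta>" "\<And>z'. (\<Sum>r<m. \<bar>z r - z' r\<bar>) < \<delta> \<Longrightarrow> \<bar>g z - g z'\<bar> < \<epsilon>"
      using assms by metis
    have "continuous_on UNIV (\<lambda>z'. \<Sum>r<m. \<bar>z r - z' r\<bar>)"
      by (intro continuous_intros continuous_on_product_coordinates)
    then have "((\<lambda>z'. \<Sum>r<m. \<bar>z r - z' r\<bar>) \<longlongrightarrow> (\<Sum>r<m. \<bar>z r - z r\<bar>)) (at z)"
      unfolding continuous_on_def by (rule bspec) simp
    then have "\<forall>\<^sub>F z' in at z. (\<Sum>r<m. \<bar>z r - z' r\<bar>) < \<delta>"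
      by (rule order_tendstoD) (use \<delta> in simp)
    then show "\<forall>\<^sub>F z' in at z. dist (g z') (g z) < \<epsilon>"
      by eventually_elim (use \<delta>(2) in \<open>simp add: dist_real_def abs_minus_commute\<close>)
  qed
qed

text \<open>A composition: the bump sum depends continuously on \<open>z\<close> in the sup norm,
  the weights on the bump sum by assumption, and the network value on the weights.\<close>

lemma continuous_on_assigned_net:
  fixes archs :: "nat \<Rightarrow> 'n::finite arch"
  assumes "continuous_assign archs assign" "0 < W" "0 < h"
  shows "continuous_on UNIV (\<lambda>z. net_fun (archs W) (assign W (bump_sum u m h z)) x)"
proof -
  let ?b = "bump_sum u m h"
  have close: "\<exists>\<delta>>0. \<forall>z'. (\<Sum>r<m. \<bar>z r - z' r\<bar>) < \<delta> \<longrightarrow>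
      (\<forall>e\<in>edges (archs W). \<bar>fst (assign W (?b z)) e - fst (assign W (?b z')) e\<bar> < \<epsilon>) \<and>
      (\<forall>v. is_hidden (archs W) v \<or> v = Out \<longrightarrow>
         \<bar>snd (assign W (?b z)) v - snd (assign W (?b z')) v\<bar> < \<epsilon>)" if \<epsilon>: "0 < \<epsilon>" for z \<epsilon>
  proof -
    obtain \<delta> where \<delta>: "0 < \<delta>" and close: "\<And>g. continuous_on unit_cube g \<Longrightarrow> sup_dist (?b z) g < \<delta> \<Longrightarrow>
      (\<forall>e\<in>edges (archs W). \<bar>fst (assign W (?b z)) e - fst (assign W g) e\<bar> < \<epsilon>) \<and>
      (\<forall>v. is_hidden (archs W) v \<or> v = Out \<longrightarrow>
         \<bar>snd (assign W (?b z)) v - snd (assign W g) v\<bar> < \<epsilon>)"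
      using assms(1)[unfolded continuous_assign_def, rule_format,
          OF assms(2) continuous_on_bump_sum \<epsilon>, of u m h z] by blast
    have "sup_dist (?b z) (?b z') < \<delta>" if "(\<Sum>r<m. \<bar>z r - z' r\<bar>) < \<delta> / h" for z'
    proof -
      have "sup_dist (?b z) (?b z') \<le> h * (\<Sum>r<m. \<bar>z r - z' r\<bar>)"
        using assms(3) by (intro sup_dist_le bump_sum_diff_le) simp
      also have "\<dots> < h * (\<delta> / h)" using that assms(3) by (intro mult_strict_left_mono)
      finally show ?thesis using assms(3) by simp
    qed
    then show ?thesis
      using close[OF continuous_on_bump_sum] \<delta> assms(3) by (intro exI[of _ "\<delta> / h"]) simp
  qed
  show ?thesis
  proof (rule continuous_on_net_fun)
    fix e assume "e \<in> edges (archs W)"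
    then show "continuous_on UNIV (\<lambda>z. fst (assign W (?b z)) e)"
      using close by (intro continuous_on_UNIV_fun_coordinates[where m = m]) meson
  next
    fix v assume v: "is_hidden (archs W) v \<or> v = Out"
    show "continuous_on UNIV (\<lambda>z. snd (assign W (?b z)) v)"
    proof (rule continuous_on_UNIV_fun_coordinates[where m = m])
      fix z and \<epsilon> :: real assume "0 < \<epsilon>"
      from close[OF this, of z] obtain \<delta> where "0 < \<delta>" "\<And>z'. (\<Sum>r<m. \<bar>z r - z' r\<bar>) < \<delta> \<Longrightarrow>
         \<forall>v. is_hidden (archs W) v \<or> v = Out \<longrightarrow>
           \<bar>snd (assign W (?b z)) v - snd (assign W (?b z')) v\<bar> < \<epsilon>"
        by blast
      then show "\<exists>\<delta>>0. \<forall>z'. (\<Sum>r<m. \<bar>z r - z' r\<bar>) < \<delta> \<longrightarrow>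
           \<bar>snd (assign W (?b z)) v - snd (assign W (?b z')) v\<bar> < \<epsilon>"
        using v by (intro exI[of _ \<delta>]) blast
    qed
  qed (rule continuous_on_const)
qed

text \<open>For every \<open>T\<close>, the values at the grid points can be steered independently
  into any of \<open>T\<close> intervals, giving \<open>T ^ m\<close> threshold patterns. The count
  allows at most \<open>C * T ^ W\<close> with \<open>C\<close> independent of \<open>T\<close>, so
  a large \<open>T\<close> forces \<open>m \<le> W\<close>.\<close>

lemma bump_count_le_num_weights:
  fixes archs :: "nat \<Rightarrow> 'n::finite arch"
  assumes cont: "continuous_assign archs assign" and W: "0 < W"
    and arch: "wf_arch (archs W)" "num_weights (archs W) = W"
    and h: "0 < h"
    and approx: "\<And>z r. \<forall>r<m. \<bar>z r\<bar> \<le> 1 \<Longrightarrow> r < m \<Longrightarrow>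
       \<bar>h * z r - net_fun (archs W) (assign W (bump_sum u m h z)) (u r)\<bar> \<le> h / 4"
  shows "m \<le> W"
proof (rule ccontr)
  assume "\<not> m \<le> W"
  then have "W < m" by simp
  define F where "F z r = net_fun (archs W) (assign W (bump_sum u m h z)) (u r)" for z r
  define C where "C = (2 * m * W ^ 2 + 1) ^ (W * depth (archs W)) * (2 * m * W + 1) ^ W"
  have bound: "T ^ m \<le> C * T ^ W" if "0 < T" for T
  proof -
    \<comment> \<open>The thresholds \<open>\<eta> * j\<close> with \<open>j < T\<close> cut the
      range from 0 to \<open>h / 2\<close> into \<open>T\<close> intervals of length
      \<open>\<eta>\<close>.\<close>
    define \<eta> where "\<eta> = h / (2 * real T)"
    have \<eta>: "0 < \<eta>" "\<eta> * real T = h / 2" using h that by (simp_all add: \<eta>_def)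
    define Ts where "Ts = (\<lambda>j. \<eta> * real j) ` {..<T}"
    have inj: "inj_on (\<lambda>j. \<eta> * real j) {..<T}" using \<eta> by (auto simp: inj_on_def)
    then have cardT: "card Ts = T" by (simp add: Ts_def card_image)
    let ?Q = "\<lambda>wh. {(r, t) \<in> {..<m} \<times> Ts. t < net_fun (archs W) wh (u r)}"
    \<comment> \<open>The pattern of a network whose value at \<open>u r\<close> lies strictly
      between \<open>\<eta> * k r\<close> and \<open>\<eta> * (k r + 1)\<close>.\<close>
    define code where "code k = {(r, t). r < m \<and> t \<in> (\<lambda>j. \<eta> * real j) ` {..k r}}" for k :: "nat \<Rightarrow> nat"
    let ?K = "PiE {..<m} (\<lambda>_. {..<T})"
    have "code k \<in> range ?Q" if k: "k \<in> ?K" for k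
    proof -
      have kT: "k r < T" if "r < m" for r using k that by (auto dest: PiE_mem)
      \<comment> \<open>Midpoints of the prescribed intervals: an error below
        \<open>\<eta> / 2\<close> keeps the value strictly inside.\<close>
      define y where "y r = \<eta> * (real (k r) + 1 / 2)" for r
      have y: "0 < y r" "y r < h / 2" if "r < m" for r
      proof -
        show "0 < y r" using \<eta> by (simp add: y_def)
        have "y r < \<eta> * real T" unfolding y_def using \<eta> kT[OF that] by (intro mult_strict_left_mono) auto
        then show "y r < h / 2" using \<eta> by simp
      qed
      \<comment> \<open>On the faces \<open>z i = 1\<close> and \<open>z i = -1\<close> the network
        value is at least \<open>3 * h / 4\<close>, respectively at most \<open>- 3 * h / 4\<close>,
        whereas \<open>y i\<close> lies between 0 and \<open>h / 2\<close>; hence the sign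
        conditions.\<close>
      have "\<exists>z. (\<forall>r<m. \<bar>z r\<bar> \<le> 1) \<and> (\<forall>r<m. \<bar>F z r - y r\<bar> < \<eta> / 2)"
      proof (rule approximate_poincare_miranda)
        show "continuous_on UNIV (\<lambda>z. F z i - y i)" for i
          unfolding F_def by (intro continuous_intros continuous_on_assigned_net cont W h)
      next
        fix z :: "nat \<Rightarrow> real" and i assume *: "\<forall>r<m. \<bar>z r\<bar> \<le> 1" "i < m" "z i = -1"
        then show "F z i - y i < 0"
          using approx[OF *(1,2)] y[OF *(2)] h unfolding F_def *(3) by linarith
      next
        fix z :: "nat \<Rightarrow> real" and i assume *: "\<forall>r<m. \<bar>z r\<bar> \<le> 1" "i < m" "z i = 1"
        then show "0 < F z i - y i"
          using approx[OF *(1,2)] y[OF *(2)] h unfolding F_def *(3) by linarith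
      qed (use \<eta> in simp)
      then obtain z where z: "\<And>r. r < m \<Longrightarrow> \<bar>F z r - y r\<bar> < \<eta> / 2" by blast
      have near: "\<eta> * real (k r) < F z r" "F z r < \<eta> * (real (k r) + 1)" if "r < m" for r
      proof -
        have "y r = \<eta> * real (k r) + \<eta> / 2" by (simp add: y_def distrib_left)
        then show "\<eta> * real (k r) < F z r" "F z r < \<eta> * (real (k r) + 1)"
          using z[OF that] unfolding distrib_left by linarith+
      qed
      have thr: "\<eta> * real j < F z r \<longleftrightarrow> j \<le> k r" if "r < m" for r j
      proof
        assume "j \<le> k r"
        then have "\<eta> * real j \<le> \<eta> * real (k r)" using \<eta> by simp
        also have "\<dots> < F z r" using near(1)[OF that] .
        finally show "\<eta> * real j < F z r" .
      next
        assume *: "\<eta> * real j < F z r"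
        with near(2)[OF that] have "\<eta> * real j < \<eta> * (real (k r) + 1)" by linarith
        then show "j \<le> k r" using \<eta> by simp
      qed
      have "?Q (assign W (bump_sum u m h z)) = code k"
        using thr kT by (fastforce simp: code_def Ts_def F_def)
      then show ?thesis by (rule range_eqI[OF sym])
    qed
    then have "code ` ?K \<subseteq> range ?Q" by blast
    moreover have "finite (range ?Q)"
      by (rule finite_subset[of _ "Pow ({..<m} \<times> Ts)"]) (auto simp: Ts_def)
    ultimately have "card (code ` ?K) \<le> card (range ?Q)" by (intro card_mono)
    moreover have "card (code ` ?K) = T ^ m"
    proof (subst card_image)
      show "inj_on code ?K"
      proof (rule inj_onI)
        fix k k' assume k: "k \<in> ?K" "k' \<in> ?K" and eq: "code k = code k'"
        have mem: "(r, \<eta> * real j) \<in> code k \<longleftrightarrow> r < m \<and> j \<le> k r" for r j k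
          using \<eta> by (auto simp: code_def)
        have "k r = k' r" if "r < m" for r
          using mem[of r "k r" k] mem[of r "k r" k'] mem[of r "k' r" k] mem[of r "k' r" k'] eq that
          by auto
        then show "k = k'" using k by (auto intro: PiE_ext)
      qed
    qed (simp add: card_PiE)
    ultimately have "T ^ m \<le> card (range ?Q)" by simp
    also have "\<dots> \<le> (2 * m * W ^ 2 + 1) ^ (W * depth (archs W)) * (2 * m * card Ts * W + 1) ^ W"
      using card_threshold_patterns_le[OF arch(1), of Ts m u] by (simp add: arch(2) Ts_def)
    also have "(2 * m * card Ts * W + 1) ^ W \<le> ((2 * m * W + 1) * T) ^ W"
      using that unfolding cardT by (intro power_mono) (simp_all add: algebra_simps)
    also have "\<dots> = (2 * m * W + 1) ^ W * T ^ W" by (rule power_mult_distrib)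
    finally show ?thesis by (simp add: C_def mult.assoc)
  qed
  \<comment> \<open>With \<open>T = Suc C\<close> the constant \<open>C\<close> is beaten by one
    further factor \<open>T\<close>, which \<open>W < m\<close> supplies.\<close>
  have "Suc C ^ m \<le> C * Suc C ^ W" by (rule bound) simp
  also have "\<dots> < Suc C * Suc C ^ W" by (rule mult_strict_right_mono) auto
  also have "\<dots> = Suc C ^ Suc W" by simp
  also have "\<dots> \<le> Suc C ^ m" using \<open>W < m\<close> by (intro power_increasing) auto
  finally show False by simp
qed

section \<open>Comparison of powers of \<open>W\<close> in the three claims\<close>

theorem theorem2:
  fixes nu_type :: "'n::finite itself"
  defines "\<nu> \<equiv> real CARD('n)"
  shows
   "(\<forall>p (archs :: nat \<Rightarrow> 'n arch) assign.
       p > 2 / \<nu> \<longrightarrow> \<not> rate_achieved p archs assign)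
  \<and> (\<forall>p (archs :: nat \<Rightarrow> 'n arch) assign.
       p > 1 / \<nu> \<longrightarrow> continuous_assign archs assign \<longrightarrow> \<not> rate_achieved p archs assign)
  \<and> (\<forall>p (archs :: nat \<Rightarrow> 'n arch) assign.
       1 / \<nu> < p \<longrightarrow> p \<le> 2 / \<nu> \<longrightarrow> rate_achieved p archs assign \<longrightarrow>
       (\<exists>d>0. \<exists>W0. \<forall>W\<ge>W0.
          real (depth (archs W)) \<ge> d * real W powr (p * \<nu> - 1) / ln (real W)))"
proof (intro conjI allI impI)
  have \<nu>: "0 < \<nu>" by (simp add: \<nu>_def)
  fix p and archs :: "nat \<Rightarrow> 'n arch" and assign
  have arch: "wf_arch (archs W)" "num_weights (archs W) = W" if "rate_achieved p archs assign" "0 < W" for W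
    using that by (auto simp: rate_achieved_def)
  {
    assume p: "2 / \<nu> < p"
    show "\<not> rate_achieved p archs assign"
    proof
      assume rate: "rate_achieved p archs assign"
      have "0 < p" using p \<nu> by (meson divide_pos_pos less_trans zero_less_numeral)
      obtain d where d: "0 < d"
        "\<forall>\<^sub>F W in sequentially. d * real W powr (p * \<nu> - 1) / ln (real W) \<le> real (depth (archs W)) + 1"
        using depth_lower_bound[OF rate \<open>0 < p\<close>] unfolding \<nu>_def by blast
      \<comment> \<open>The excess of the exponent: the depth bound has order
        \<open>W powr (q + 1) / ln W\<close>, which outgrows \<open>W\<close>, whereas depth plus
        one is at most \<open>W\<close>.\<close>
      define q where "q = p * \<nu> - 2"
      have "0 < q" using p \<nu> by (simp add: q_def field_simps)
      then have "\<forall>\<^sub>F W in sequentially. real W < d * real W powr (q + 1) / ln (real W)"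
        using d(1) by real_asymp
      with d(2) eventually_gt_at_top[of 0] have "\<forall>\<^sub>F W in sequentially. False"
      proof eventually_elim
        case (elim W)
        have "depth (archs W) + 1 \<le> W"
          using depth_less_num_weights[OF arch(1)[OF rate, of W]] arch(2)[OF rate, of W] elim by simp
        then have "real (depth (archs W)) + 1 \<le> real W" by linarith
        moreover have eq: "q + 1 = p * \<nu> - 1" by (simp add: q_def)
        ultimately show False using elim unfolding eq by linarith
      qed
      then show False by simp
    qed
  }
  {
    assume p: "1 / \<nu> < p" and cont: "continuous_assign archs assign"
    show "\<not> rate_achieved p archs assign"
    proof
      assume rate: "rate_achieved p archs assign"
      have "0 < p" using p \<nu> by (meson divide_pos_pos less_trans zero_less_one)
      obtain c where c: "0 < c" and ev: "\<forall>\<^sub>F W in sequentially. \<exists>m h u.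
         c * real W powr (p * \<nu>) \<le> real m \<and> real m \<le> real W powr (p * \<nu>) \<and>
         0 < h \<and>
         (\<forall>z. (\<forall>r<m. \<bar>z r\<bar> \<le> 1) \<longrightarrow>
          (\<forall>r<m. \<bar>h * z r - net_fun (archs W) (assign W (bump_sum u m h z)) (u r)\<bar> \<le> h / 4))"
        using rate_achieved_bump_sums[OF rate \<open>0 < p\<close>] unfolding \<nu>_def by blast
      \<comment> \<open>Here the number of grid points is at least of order
        \<open>W powr (q + 1)\<close>, which outgrows \<open>W\<close>, against
        \<open>m \<le> W\<close>.\<close>
      define q where "q = p * \<nu> - 1"
      have "0 < q" using p \<nu> by (simp add: q_def field_simps)
      then have "\<forall>\<^sub>F W in sequentially. real W < c * real W powr (q + 1)"
        using c by real_asymp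
      with ev eventually_gt_at_top[of 0] have "\<forall>\<^sub>F W in sequentially. False"
      proof eventually_elim
        case (elim W)
        then obtain m h u where m: "c * real W powr (p * \<nu>) \<le> real m" and h: "0 < h"
          and approx: "\<And>z r. \<forall>r<m. \<bar>z r\<bar> \<le> 1 \<Longrightarrow> r < m \<Longrightarrow>
            \<bar>h * z r - net_fun (archs W) (assign W (bump_sum u m h z)) (u r)\<bar> \<le> h / 4"
          by blast
        have "m \<le> W"
          using bump_count_le_num_weights[OF cont _ arch[OF rate] h approx] elim by blast
        moreover have "real W < c * real W powr (p * \<nu>)" using elim by (simp add: q_def)
        ultimately show False using m by linarith
      qed
      then show False by simp
    qed
  }
  {
    assume p: "1 / \<nu> < p" and rate: "rate_achieved p archs assign"
    have "0 < p" using p \<nu> by (meson divide_pos_pos less_trans zero_less_one)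
    obtain d where d: "0 < d"
      "\<forall>\<^sub>F W in sequentially. d * real W powr (p * \<nu> - 1) / ln (real W) \<le> real (depth (archs W)) + 1"
      using depth_lower_bound[OF rate \<open>0 < p\<close>] unfolding \<nu>_def by blast
    define q where "q = p * \<nu> - 1"
    have "0 < q" using p \<nu> by (simp add: q_def field_simps)
    \<comment> \<open>Once the bound is at least 2, removing the \<open>+ 1\<close> costs at most
      half of it, so \<open>d / 2\<close> serves as the constant.\<close>
    then have "\<forall>\<^sub>F W in sequentially. 2 \<le> d * real W powr q / ln (real W)"
      using d(1) by real_asymp
    with d(2) have "\<forall>\<^sub>F W in sequentially.
        d / 2 * real W powr (p * \<nu> - 1) / ln (real W) \<le> real (depth (archs W))"
    proof eventually_elim
      case (elim W)
      have "t / 2 \<le> real (depth (archs W))" if "t \<le> real (depth (archs W)) + 1" "2 \<le> t" for t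
        using that by linarith
      from this[OF elim[unfolded q_def]] show ?case by simp
    qed
    then show "\<exists>d>0. \<exists>W0. \<forall>W\<ge>W0. d * real W powr (p * \<nu> - 1) / ln (real W) \<le> real (depth (archs W))"
      using d(1) unfolding eventually_sequentially by (intro exI[of _ "d / 2"]) simp
  }
qed

end
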